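(* Let $N\ge3$, let $m,n\ge2$ be integers with $m+n=N+1$, and let $G=O(m)\times O(n)$. Let $s\in(1/2,1)$ and $$\mathcal Z:=(\mathbb S^{m-1}\times\{0\})\cup(\{0\}\times\mathbb S^{n-1})\subset\mathbb S^N .$$ For any $u\in H^s_g(\mathbb S^N)^G$ there exists $\widetilde u\in C^0(\mathbb S^N\setminus\mathcal Z)$ such that $u=\widetilde u$ a.e. in $\mathbb S^N$.
   Context: $G=O(m)\times O(n)\subset O(N+1)$ acts on the unit sphere $\mathbb S^N\subset\mathbb R^{N+1}=\mathbb R^m\times\mathbb R^n$ with round metric $g$ and volume element $dV_g$. With $c_{N,s}=4^s\pi^{-N/2}\frac{\Gamma(\frac N2+s)}{\Gamma(2-s)}s(1-s)$ and $A_{N,s}=\frac{\Gamma(\frac N2+s)}{\Gamma(\frac N2-s)}$, $H^s_g(\mathbb S^N)$ is the closure of $C^\infty(\mathbb S^N)$ in $L^2_g(\mathbb S^N)$ for the norm $\|u\|_{H^s_g(\mathbb S^N)}=\Big(\frac{c_{N,s}}2\iint_{\mathbb S^N\times\mathbb S^N}\frac{|u(z)-u(\zeta)|^2}{|z-\zeta|^{N+2s}}dV_g(z)dV_g(\zeta)+A_{N,s}\int_{\mathbb S^N}u^2dV_g\Big)^{1/2}$, and $H^s_g(\mathbb S^N)^G$ is the subspace of $G$-invariant functions ($u(\gamma z)=u(z)$ for all $\gamma\in G$). *)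

theory Defs
  imports "HOL-Analysis.Analysis"
begin

section \<open>Volume element of the round sphere\<close>

text \<open>
  The unit sphere of a Euclidean space of dimension \<open>N + 1 = DIM('a)\<close> carries the measure
  \<open>dV\<^sub>g\<close> for which polar coordinates read \<open>dx = r^N dr dV\<^sub>g\<close>. Integrating over \<open>0 < r \<le> 1\<close>
  gives \<open>dV\<^sub>g(A) = (N + 1) \<cdot> Leb {x. 0 < |x| \<le> 1 \<and> x/|x| \<in> A}\<close>, which serves as the definition;
  see \<open>emeasure_borel_sphere_volume\<close>. The measure is completed, so that measurable
  functions on the sphere are the Lebesgue measurable ones.
\<close>

definition borel_sphere_volume :: "'a::euclidean_space measure" where
  "borel_sphere_volume =
     scale_measure (of_nat DIM('a))
       (distr (restrict_space lborel (cball 0 1 - {0})) (restrict_space borel (sphere 0 1))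
          (\<lambda>x. x /\<^sub>R norm x))"

definition sphere_volume :: "'a::euclidean_space measure" where
  "sphere_volume = completion borel_sphere_volume"

lemma space_sphere_volume: "space (sphere_volume :: 'a::euclidean_space measure) = sphere 0 1"
  by (simp add: sphere_volume_def borel_sphere_volume_def space_scale_measure space_restrict_space)

lemma emeasure_borel_sphere_volume:
  fixes A :: "'a::euclidean_space set"
  assumes "A \<in> sets borel" "A \<subseteq> sphere 0 1"
  shows "emeasure borel_sphere_volume A =
    of_nat DIM('a) * emeasure lborel {x. 0 < norm x \<and> norm x \<le> 1 \<and> x /\<^sub>R norm x \<in> A}"
proof -
  have meas: "(\<lambda>x::'a. x /\<^sub>R norm x) \<in>
      restrict_space lborel (cball 0 1 - {0}) \<rightarrow>\<^sub>M restrict_space borel (sphere 0 1)"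
    by (rule measurable_restrict_space3) auto
  have "A \<in> sets (restrict_space borel (sphere 0 1))"
    using assms by (subst sets_restrict_space_iff) auto
  then have "emeasure borel_sphere_volume A = of_nat DIM('a) *
      emeasure (restrict_space lborel (cball 0 1 - {0}))
        ((\<lambda>x. x /\<^sub>R norm x) -` A \<inter> (cball 0 1 - {0}))"
    unfolding borel_sphere_volume_def
    by (simp add: emeasure_distr[OF meas] space_restrict_space)
  also have "emeasure (restrict_space lborel (cball 0 1 - {0}))
        ((\<lambda>x. x /\<^sub>R norm x) -` A \<inter> (cball 0 1 - {0}))
      = emeasure lborel ((\<lambda>x. x /\<^sub>R norm x) -` A \<inter> (cball 0 1 - {0}))"
    by (rule emeasure_restrict_space) auto
  also have "(\<lambda>x. x /\<^sub>R norm x) -` A \<inter> (cball 0 1 - {0}) =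
      {x. 0 < norm x \<and> norm x \<le> 1 \<and> x /\<^sub>R norm x \<in> A}"
    by auto
  finally show ?thesis .
qed

section \<open>Smooth functions\<close>

primrec Ck_on :: "nat \<Rightarrow> 'a set \<Rightarrow> ('a::real_normed_vector \<Rightarrow> real) \<Rightarrow> bool" where
  "Ck_on 0 U f \<longleftrightarrow> continuous_on U f"
| "Ck_on (Suc k) U f \<longleftrightarrow>
     (\<forall>x\<in>U. f differentiable (at x)) \<and>
     (\<forall>v. Ck_on k U (\<lambda>x. frechet_derivative f (at x) v))"

definition smooth_on :: "'a set \<Rightarrow> ('a::real_normed_vector \<Rightarrow> real) \<Rightarrow> bool" where
  "smooth_on U f \<longleftrightarrow> (\<forall>k. Ck_on k U f)"

text \<open>
  Smoothness on the embedded submanifold: near every point of the sphere, \<open>f\<close> is the restriction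
  of a smooth function on an open subset of the ambient space. Values of \<open>f\<close> off the sphere
  are irrelevant.
\<close>

definition smooth_on_sphere :: "('a::euclidean_space \<Rightarrow> real) \<Rightarrow> bool" where
  "smooth_on_sphere f \<longleftrightarrow>
     (\<forall>p \<in> sphere 0 1. \<exists>U F. open U \<and> p \<in> U \<and> smooth_on U F \<and> (\<forall>x \<in> U \<inter> sphere 0 1. f x = F x))"

section \<open>The fractional Sobolev space\<close>

definition c_const :: "nat \<Rightarrow> real \<Rightarrow> real" where
  "c_const N s = 4 powr s * pi powr (- (real N / 2)) *
     (Gamma (real N / 2 + s) / Gamma (2 - s)) * s * (1 - s)"

definition A_const :: "nat \<Rightarrow> real \<Rightarrow> real" where
  "A_const N s = Gamma (real N / 2 + s) / Gamma (real N / 2 - s)"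

definition Hs_sqnorm :: "nat \<Rightarrow> real \<Rightarrow> ('a::euclidean_space \<Rightarrow> real) \<Rightarrow> ennreal" where
  "Hs_sqnorm N s u =
     ennreal (c_const N s / 2) *
       (\<integral>\<^sup>+ (z, \<zeta>). ennreal (\<bar>u z - u \<zeta>\<bar>\<^sup>2 / norm (z - \<zeta>) powr (real N + 2 * s))
          \<partial>(sphere_volume \<Otimes>\<^sub>M sphere_volume)) +
     ennreal (A_const N s) * (\<integral>\<^sup>+ z. ennreal ((u z)\<^sup>2) \<partial>sphere_volume)"

text \<open>The norm takes the value \<open>\<infinity>\<close> on functions of infinite energy.\<close>

definition Hs_norm :: "nat \<Rightarrow> real \<Rightarrow> ('a::euclidean_space \<Rightarrow> real) \<Rightarrow> ennreal" where
  "Hs_norm N s u =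
     (if Hs_sqnorm N s u = \<infinity> then \<infinity> else ennreal (sqrt (enn2real (Hs_sqnorm N s u))))"

definition L2_sphere :: "('a::euclidean_space \<Rightarrow> real) set" where
  "L2_sphere = {u \<in> borel_measurable sphere_volume. (\<integral>\<^sup>+ z. ennreal ((u z)\<^sup>2) \<partial>sphere_volume) < \<infinity>}"

text \<open>
  Elements of \<open>L\<^sup>2\<close> and of the spaces below are represented by functions; no choice of
  representative is made, and all conditions are invariant under a.e. equality.
  The parameter \<open>N\<close> is meant to be the dimension \<open>DIM('a) - 1\<close> of the sphere.
\<close>

definition Hs_sphere :: "nat \<Rightarrow> real \<Rightarrow> ('a::euclidean_space \<Rightarrow> real) set" where
  "Hs_sphere N s =
     {u \<in> L2_sphere. \<forall>\<epsilon>>0. \<exists>\<phi>. smooth_on_sphere \<phi> \<and> Hs_norm N s (\<lambda>z. u z - \<phi> z) < ennreal \<epsilon>}"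

section \<open>The action of \<open>O(m) \<times> O(n)\<close>\<close>

definition block_orthogonal :: "((real^'m^'m) \<times> (real^'n^'n)) set" where
  "block_orthogonal = {A. orthogonal_matrix A} \<times> {B. orthogonal_matrix B}"

definition block_act :: "(real^'m^'m) \<times> (real^'n^'n) \<Rightarrow> (real^'m) \<times> (real^'n) \<Rightarrow> (real^'m) \<times> (real^'n)"
  where "block_act \<gamma> z = (fst \<gamma> *v fst z, snd \<gamma> *v snd z)"

text \<open>
  Invariance of a class in \<open>L\<^sup>2\<close>: for every \<open>\<gamma>\<close> the identity \<open>u \<circ> \<gamma> = u\<close> holds in \<open>L\<^sup>2\<close>,
  so the exceptional null set may depend on \<open>\<gamma>\<close>.
\<close>

definition Hs_sphere_inv :: "nat \<Rightarrow> real \<Rightarrow> ((real^'m) \<times> (real^'n) \<Rightarrow> real) set" where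
  "Hs_sphere_inv N s =
     {u \<in> Hs_sphere N s. \<forall>\<gamma>\<in>block_orthogonal. AE z in sphere_volume. u (block_act \<gamma> z) = u z}"

definition singular_set :: "((real^'m) \<times> (real^'n)) set" where
  "singular_set = (sphere 0 1 \<times> {0}) \<union> ({0} \<times> sphere 0 1)"

end

theory Submission
  imports Defs
begin

text \<open>
  Let \<open>v\<close> be a Borel representative of \<open>u\<close>, and let \<open>v\<^sub>h(z)\<close> be its mean over the
  spherical cap of radius \<open>h\<close> around \<open>z\<close>. The limit of \<open>v\<^sub>h\<close> along \<open>h = 2^(-j)\<close> is shown to be the continuous
  representative.

  By the definition of the space as a closure there is a smooth \<open>\<phi>\<close> such that \<open>w = v - \<phi>\<close> has finite
  Gagliardo energy \<open>\<integral>\<integral> |w(a) - w(b)|\<^sup>2 / |a - b|^(N + 2s)\<close>. Only the Lipschitz bound of \<open>\<phi>\<close> on the sphere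
  matters: it contributes \<open>O(h\<^sup>2)\<close> to every squared oscillation at scale \<open>h\<close>, so the energy of \<open>\<phi>\<close>
  itself is never needed.

  The main estimate (\<open>cap_mean_holder_estimate\<close>) is
  \<open>|v\<^sub>h(z) - v\<^sub>k(z')|\<^sup>2 \<le> K h^(2s - 1)\<close> for \<open>|z - z'| \<le> h\<close> and \<open>h/2 \<le> k \<le> h \<le> 1\<close>, uniformly as long as both
  block components of \<open>z\<close> have norm at least \<open>\<delta> > 0\<close>. By the Cauchy-Schwarz inequality the left side
  is at most the average of \<open>|v(a) - v(b)|\<^sup>2\<close> over the product of the two caps. By invariance of \<open>v\<close> and
  of the volume, this average does not change when both caps are moved by an element of the group.
  The orbit of \<open>z\<close> is a product of spheres of dimensions \<open>m - 1\<close> and \<open>n - 1\<close>, hence it contains at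
  least \<open>\<kappa> h^(1 - N)\<close> points with mutual distance at least \<open>4h\<close> (\<open>orbit_separated_points\<close>). The corresponding
  pieces of the energy are disjoint and all of them together are bounded by the total energy, so each
  average gains the factor \<open>h^(N - 1)\<close> (\<open>card_times_cap_osc_le\<close>). Since a cap has volume at
  least \<open>c h^N\<close> (\<open>cap_volume_lower_bound\<close>), the power of \<open>h\<close> that remains is
  \<open>(N + 2s) + (N - 1) - 2N = 2s - 1 > 0\<close>.

  Consequently \<open>v\<^sub>h\<close> converges geometrically along \<open>h = 2^(-j)\<close>, locally uniformly off the singular set, and
  its oscillation over distances at most \<open>h\<close> tends to zero, so the limit is continuous
  (\<open>continuous_on_lim_geometric\<close>). Finally \<open>\<integral> |w(z) - w(b)|\<^sup>2 / |z - b|^(N + 2s) db\<close> is finite for almost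
  every \<open>z\<close>, and at such points \<open>v\<^sub>h(z) \<longlonglongrightarrow> v(z)\<close> (\<open>cap_mean_converges_AE\<close>).
\<close>

section \<open>Invariance of the round volume and volume of caps\<close>

lemma orthogonal_transformation_dist:
  fixes T :: "'a::euclidean_space \<Rightarrow> 'a"
  shows "orthogonal_transformation T \<Longrightarrow> dist (T x) (T y) = dist x y"
  by (simp add: orthogonal_transformation_isometry)

lemma orthogonal_transformation_continuous_on:
  fixes T :: "'a::euclidean_space \<Rightarrow> 'a"
  assumes "orthogonal_transformation T"
  shows "continuous_on S T"
  using assms by (intro linear_continuous_on)
    (simp add: orthogonal_transformation_linear flip: linear_conv_bounded_linear)

lemma normalized_preimage_borel:
  fixes A :: "'a::euclidean_space set"
  assumes [measurable]: "A \<in> sets borel"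
  shows "{x. 0 < norm x \<and> norm x \<le> 1 \<and> x /\<^sub>R norm x \<in> A} \<in> sets borel"
  by measurable

text \<open>
  By the Vitali covering theorem an open set is, up to a null set, a countable disjoint union of
  balls, and the preimage of a ball under an isometry is a ball of the same radius.
\<close>
lemma emeasure_open_le_vimage_orthogonal:
  fixes T :: "'a::euclidean_space \<Rightarrow> 'a"
  assumes T: "orthogonal_transformation T" and U: "open U"
  shows "emeasure lborel U \<le> emeasure lborel (T -` U)"
proof -
  let ?K = "{(x, r). 0 < r \<and> ball x r \<subseteq> U}"
  have cover: "\<exists>i. i \<in> ?K \<and> x \<in> ball (fst i) (snd i) \<and> snd i < d" if "x \<in> U" "0 < d" for x d
  proof -
    obtain e where e: "e > 0" "ball x e \<subseteq> U" using U \<open>x \<in> U\<close> open_contains_ball by blast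
    have "ball x (min e (d/2)) \<subseteq> U" using e by auto
    then show ?thesis using e that by (intro exI[of _ "(x, min e (d/2))"]) auto
  qed
  obtain C where C: "countable C" "C \<subseteq> ?K"
    and pw: "pairwise (\<lambda>i j. disjnt (ball (fst i) (snd i)) (ball (fst j) (snd j))) C"
    and neg: "negligible (U - (\<Union>i\<in>C. ball (fst i) (snd i)))"
    by (rule Vitali_covering_theorem_balls[of U ?K fst snd, OF cover])
  define W where "W = (\<Union>i\<in>C. ball (fst i) (snd i))"
  have WU: "W \<subseteq> U" using C(2) by (fastforce simp: W_def)
  have oW: "open W" by (auto simp: W_def)
  have "U - W \<in> null_sets lebesgue" using neg by (simp add: W_def negligible_iff_null_sets)
  then have null: "U - W \<in> null_sets lborel"
    using U oW by (simp add: null_sets_completion_iff)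
  have "U = W \<union> (U - W)" using WU by auto
  then have "emeasure lborel U = emeasure lborel W"
    using emeasure_Un_null_set[OF _ null, of W] oW by simp
  also have "\<dots> = (\<integral>\<^sup>+i. emeasure lborel (ball (fst i) (snd i)) \<partial>count_space C)"
    unfolding W_def using pw C(1)
    by (intro emeasure_UN_countable) (auto simp: disjoint_family_on_def pairwise_def disjnt_def)
  also have "\<dots> = (\<integral>\<^sup>+i. emeasure lborel (T -` ball (fst i) (snd i)) \<partial>count_space C)"
  proof (rule nn_integral_cong)
    fix i assume "i \<in> space (count_space C)"
    then have r: "0 < snd i" using C(2) by auto
    have bij: "bij T" by (rule orthogonal_transformation_bij[OF T])
    obtain y where y: "T y = fst i" using bij by (metis bij_pointE)
    have "dist (T y) (T x) = dist y x" for x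
      using T by (simp add: orthogonal_transformation_isometry)
    then have "T -` ball (fst i) (snd i) = ball y (snd i)"
      using y by auto
    then show "emeasure lborel (ball (fst i) (snd i)) = emeasure lborel (T -` ball (fst i) (snd i))"
      using r by (simp add: emeasure_ball)
  qed
  also have "\<dots> = emeasure lborel (\<Union>i\<in>C. T -` ball (fst i) (snd i))"
  proof (rule emeasure_UN_countable[symmetric])
    have "continuous_on UNIV T"
      by (rule orthogonal_transformation_continuous_on[OF T])
    then show "T -` ball (fst i) (snd i) \<in> sets lborel" for i
      by (simp add: borel_open open_vimage)
    show "disjoint_family_on (\<lambda>i. T -` ball (fst i) (snd i)) C"
      using pw by (fastforce simp: disjoint_family_on_def pairwise_def disjnt_def)
  qed (rule C(1))
  also have "\<dots> \<le> emeasure lborel (T -` U)"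
  proof (rule emeasure_mono)
    have "continuous_on UNIV T"
      by (rule orthogonal_transformation_continuous_on[OF T])
    then show "T -` U \<in> sets lborel" using U by (simp add: borel_open open_vimage)
    show "(\<Union>i\<in>C. T -` ball (fst i) (snd i)) \<subseteq> T -` U" using WU by (auto simp: W_def)
  qed
  finally show ?thesis .
qed

lemma lborel_distr_orthogonal:
  fixes T :: "'a::euclidean_space \<Rightarrow> 'a"
  assumes T: "orthogonal_transformation T"
  shows "distr lborel borel T = lborel"
proof (rule lborel_eqI[symmetric])
  have cont: "continuous_on UNIV T"
    by (rule orthogonal_transformation_continuous_on[OF T])
  then have meas: "T \<in> borel_measurable lborel"
    by (simp add: borel_measurable_continuous_onI)
  fix l u :: 'a assume le: "\<And>b. b \<in> Basis \<Longrightarrow> l \<bullet> b \<le> u \<bullet> b"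
  \<comment> \<open>The inequality of the previous lemma, applied to \<open>T\<close> and to its inverse, gives equality.\<close>
  have "inv T -` (T -` box l u) = box l u"
    using orthogonal_transformation_surj[OF T] by (auto simp: surj_f_inv_f)
  moreover have "open (T -` box l u)" using cont by (intro open_vimage open_box)
  ultimately have "emeasure lborel (T -` box l u) = emeasure lborel (box l u)"
    using emeasure_open_le_vimage_orthogonal[OF T open_box, of l u]
      emeasure_open_le_vimage_orthogonal[OF orthogonal_transformation_inv[OF T], of "T -` box l u"]
    by (metis antisym)
  then show "emeasure (distr lborel borel T) (box l u) = (\<Prod>b\<in>Basis. (u - l) \<bullet> b)"
    using meas le by (subst emeasure_distr) auto
qed simp

lemma space_borel_sphere_volume [simp]:
  "space (borel_sphere_volume :: 'a::euclidean_space measure) = sphere 0 1"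
  by (simp add: borel_sphere_volume_def space_scale_measure space_restrict_space)

lemma sets_borel_sphere_volume:
  "sets (borel_sphere_volume :: 'a::euclidean_space measure) = sets (restrict_space borel (sphere 0 1))"
  by (simp add: borel_sphere_volume_def)

lemma sets_borel_sphere_volume_iff:
  "A \<in> sets (borel_sphere_volume :: 'a::euclidean_space measure) \<longleftrightarrow> A \<in> sets borel \<and> A \<subseteq> sphere 0 1"
  unfolding sets_borel_sphere_volume by (subst sets_restrict_space_iff) auto

lemma id_measurable_borel_sphere_volume [measurable]:
  "(\<lambda>x. x) \<in> borel_sphere_volume \<rightarrow>\<^sub>M (borel :: 'a::euclidean_space measure)"
  by (subst measurable_cong_sets[OF sets_borel_sphere_volume refl]) (simp add: measurable_restrict_space1)

lemma finite_borel_sphere_volume: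
  "finite_measure (borel_sphere_volume :: 'a::euclidean_space measure)"
proof
  have "emeasure lborel {x::'a. 0 < norm x \<and> norm x \<le> 1 \<and> x /\<^sub>R norm x \<in> sphere 0 1}
      \<le> emeasure lborel (cball (0::'a) 1)"
    by (rule emeasure_mono) auto
  also have "\<dots> < \<infinity>" using emeasure_lborel_cball_finite by auto
  finally show "emeasure (borel_sphere_volume :: 'a measure) (space borel_sphere_volume) \<noteq> \<infinity>"
    by (simp add: emeasure_borel_sphere_volume ennreal_mult_eq_top_iff)
qed

lemma distr_borel_sphere_volume_orthogonal:
  fixes T :: "'a::euclidean_space \<Rightarrow> 'a"
  assumes T: "orthogonal_transformation T"
  shows "T \<in> borel_sphere_volume \<rightarrow>\<^sub>M borel_sphere_volume"
    and "distr borel_sphere_volume borel_sphere_volume T = borel_sphere_volume"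
proof -
  have lin: "linear T" using T by (simp add: orthogonal_transformation_linear)
  have nT: "norm (T x) = norm x" for x using T by (rule orthogonal_transformation_norm)
  then have T0: "T x = 0 \<longleftrightarrow> x = 0" for x by (metis norm_eq_zero)
  have meas: "T \<in> borel \<rightarrow>\<^sub>M borel"
    by (intro borel_measurable_continuous_onI orthogonal_transformation_continuous_on[OF T])
  then show M: "T \<in> borel_sphere_volume \<rightarrow>\<^sub>M borel_sphere_volume"
    by (subst measurable_cong_sets[OF sets_borel_sphere_volume sets_borel_sphere_volume])
       (rule measurable_restrict_space3, auto simp: nT)
  show "distr borel_sphere_volume borel_sphere_volume T = borel_sphere_volume"
  proof (rule measure_eqI)
    fix A assume "A \<in> sets (distr borel_sphere_volume borel_sphere_volume T)"
    then have A': "A \<in> sets (borel_sphere_volume :: 'a measure)" by simp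
    then have A: "A \<in> sets borel" "A \<subseteq> sphere 0 1" by (auto simp: sets_borel_sphere_volume_iff)
    define R where "R = {x::'a. 0 < norm x \<and> norm x \<le> 1 \<and> x /\<^sub>R norm x \<in> A}"
    have [measurable]: "R \<in> sets borel" unfolding R_def using A(1) by (rule normalized_preimage_borel)
    have vA: "T -` A \<inter> sphere 0 1 \<in> sets borel_sphere_volume"
      using measurable_sets[OF M A'] by simp
    have "emeasure (distr borel_sphere_volume borel_sphere_volume T) A
        = emeasure borel_sphere_volume (T -` A \<inter> sphere 0 1)"
      using M A' by (simp add: emeasure_distr)
    also have "\<dots> = of_nat DIM('a) * emeasure lborel
        {x. 0 < norm x \<and> norm x \<le> 1 \<and> x /\<^sub>R norm x \<in> T -` A \<inter> sphere 0 1}"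
      using vA by (intro emeasure_borel_sphere_volume) (auto simp: sets_borel_sphere_volume_iff)
    also have "{x. 0 < norm x \<and> norm x \<le> 1 \<and> x /\<^sub>R norm x \<in> T -` A \<inter> sphere 0 1} = T -` R"
      using A(2) by (auto simp: R_def nT T0 linear_scale[OF lin])
    also have "emeasure lborel (T -` R) = emeasure (distr lborel borel T) R"
      using meas by (subst emeasure_distr) auto
    also have "of_nat DIM('a) * \<dots> = emeasure borel_sphere_volume A"
      using A by (simp add: lborel_distr_orthogonal[OF T] emeasure_borel_sphere_volume R_def)
    finally show "emeasure (distr borel_sphere_volume borel_sphere_volume T) A
        = emeasure borel_sphere_volume A" .
  qed simp
qed

text \<open>
  The cone over a cap of radius \<open>h\<close> contains about \<open>1 / h\<close> disjoint balls of radius \<open>h / 8\<close>, centred on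
  the ray through the centre of the cap.
\<close>
lemma cap_volume_lower_bound:
  fixes z :: "'a::euclidean_space"
  assumes z: "z \<in> sphere 0 1" and h: "0 < h" "h \<le> 1"
  shows "measure borel_sphere_volume (ball z h \<inter> sphere 0 1)
      \<ge> DIM('a) * measure lborel (ball (0::'a) (1/8)) * h ^ (DIM('a) - 1)"
proof -
  interpret finite_measure "borel_sphere_volume :: 'a measure" by (rule finite_borel_sphere_volume)
  \<comment> \<open>The centres have mutual distance at least \<open>h / 4\<close> and norms between \<open>1 / 2\<close> and \<open>3 / 4\<close>, so the balls stay
    inside the unit ball and the normalization has a bounded Lipschitz constant on them.\<close>
  define J where "J = nat \<lfloor>1 / h\<rfloor>"
  define t where "t j = 1/2 + real j * (h / 4)" for j
  define R where "R = {x::'a. 0 < norm x \<and> norm x \<le> 1 \<and> x /\<^sub>R norm x \<in> ball z h \<inter> sphere 0 1}"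
  have [measurable]: "R \<in> sets borel" unfolding R_def by (rule normalized_preimage_borel) simp
  have nz: "norm z = 1" using z by simp
  have Jh: "real j * h \<le> 1" if "j \<le> J" for j
  proof -
    have "real j \<le> real J" using that by simp
    also have "\<dots> \<le> 1 / h" unfolding J_def using h by (intro of_nat_floor) simp
    finally have "real j \<le> 1 / h" .
    then show ?thesis using h by (simp add: field_simps)
  qed
  have J1: "1 / h \<le> real (card {..J})" unfolding J_def by simp linarith
  have sub: "ball (t j *\<^sub>R z) (h / 8) \<subseteq> R" if "j \<le> J" for j
  proof
    fix x assume "x \<in> ball (t j *\<^sub>R z) (h / 8)"
    then have x: "norm (x - t j *\<^sub>R z) < h / 8" by (simp add: dist_norm norm_minus_commute)
    have t: "1/2 \<le> t j" "t j \<le> 3/4" using h Jh[OF that] by (auto simp: t_def)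
    have d: "\<bar>norm x - t j\<bar> < h / 8"
      using norm_triangle_ineq3[of x "t j *\<^sub>R z"] x nz t by simp
    have n: "0 < norm x" "norm x \<le> 1" "3/8 \<le> norm x" using d t h by linarith+
    have "norm (x - norm x *\<^sub>R z) \<le> norm (x - t j *\<^sub>R z) + norm ((t j - norm x) *\<^sub>R z)"
      by (rule order_trans[OF _ norm_triangle_ineq]) (simp add: algebra_simps)
    also have "\<dots> < h / 4" using x d by (simp add: nz abs_minus_commute[of "t j"])
    finally have *: "norm (x - norm x *\<^sub>R z) < h / 4" .
    have "x /\<^sub>R norm x - z = (x - norm x *\<^sub>R z) /\<^sub>R norm x" using n by (simp add: algebra_simps)
    then have "norm (x /\<^sub>R norm x - z) = norm (x - norm x *\<^sub>R z) / norm x"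
      by (simp add: divide_inverse)
    also have "\<dots> < h" 
    proof -
      have "h / 4 \<le> h * norm x" using n h mult_left_mono[of "3/8" "norm x" h] by simp
      then show ?thesis using * n by (simp add: divide_less_eq)
    qed
    finally show "x \<in> R" using n by (auto simp: R_def dist_norm norm_minus_commute)
  qed
  have disj: "disjoint_family_on (\<lambda>j. ball (t j *\<^sub>R z) (h / 8)) {..J}"
  proof (clarsimp simp: disjoint_family_on_def)
    fix i j :: nat assume "i \<noteq> j"
    have "dist (t i *\<^sub>R z) (t j *\<^sub>R z) = \<bar>t i - t j\<bar>"
      by (simp add: dist_norm nz flip: scaleR_diff_left)
    also have "t i - t j = (real i - real j) * (h / 4)" by (simp add: t_def algebra_simps)
    also have "\<bar>\<dots>\<bar> = \<bar>real i - real j\<bar> * (h / 4)" using h by (simp add: abs_mult)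
    also have "\<dots> \<ge> 1 * (h / 4)" using \<open>i \<noteq> j\<close> h by (intro mult_right_mono) auto
    finally show "ball (t i *\<^sub>R z) (h / 8) \<inter> ball (t j *\<^sub>R z) (h / 8) = {}"
      by (intro disjoint_ballI) simp
  qed
  have ballm: "emeasure lborel (ball c (h / 8)) = ennreal (h ^ DIM('a) * measure lborel (ball (0::'a) (1/8)))"
    for c :: 'a
    using h by (simp add: emeasure_ball content_ball ennreal_mult[symmetric] power_divide mult_ac)
  have "ennreal (measure lborel (ball (0::'a) (1/8)) * h ^ (DIM('a) - 1))
      = ennreal ((1 / h) * (h ^ DIM('a) * measure lborel (ball (0::'a) (1/8))))"
    using h by (simp add: power_eq_if[of h "DIM('a)"])
  also have "\<dots> \<le> ennreal (real (card {..J}) * (h ^ DIM('a) * measure lborel (ball (0::'a) (1/8))))"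
    using J1 h by (intro ennreal_leI mult_right_mono) auto
  also have "\<dots> = (\<Sum>j\<le>J. emeasure lborel (ball (t j *\<^sub>R z) (h / 8)))"
    using h by (simp add: ballm ennreal_mult' ennreal_of_nat_eq_real_of_nat del: card_atMost)
  also have "\<dots> = emeasure lborel (\<Union>j\<le>J. ball (t j *\<^sub>R z) (h / 8))"
    using disj by (intro sum_emeasure) auto
  also have "\<dots> \<le> emeasure lborel R"
    using sub by (intro emeasure_mono) auto
  finally have "ennreal (DIM('a)) * ennreal (measure lborel (ball (0::'a) (1/8)) * h ^ (DIM('a) - 1))
      \<le> ennreal (DIM('a)) * emeasure lborel R"
    by (intro mult_left_mono) auto
  also have "\<dots> = emeasure borel_sphere_volume (ball z h \<inter> sphere 0 1)"
    unfolding R_def by (subst emeasure_borel_sphere_volume) (auto simp: ennreal_of_nat_eq_real_of_nat)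
  also have "\<dots> = ennreal (measure borel_sphere_volume (ball z h \<inter> sphere 0 1))"
    by (simp add: emeasure_eq_measure)
  finally show ?thesis
    using h by (simp add: ennreal_mult[symmetric] mult_ac)
qed

section \<open>Smooth functions on the sphere are Lipschitz\<close>

lemma smooth_on_locally_lipschitz:
  fixes F :: "'a::euclidean_space \<Rightarrow> real"
  assumes F: "smooth_on U F" and p: "cball p e \<subseteq> U"
  obtains L where "L-lipschitz_on (cball p e) F"
proof -
  have "Ck_on (Suc 0) U F" using F unfolding smooth_on_def by blast
  then have diff: "\<forall>x\<in>U. F differentiable (at x)"
    and cont: "\<And>v. continuous_on U (\<lambda>x. frechet_derivative F (at x) v)"
    by auto
  let ?g = "\<lambda>x. \<Sum>b\<in>Basis. \<bar>frechet_derivative F (at x) b\<bar>"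
  have "continuous_on (cball p e) ?g"
    by (intro continuous_intros continuous_on_subset[OF cont p])
  then have "bounded (?g ` cball p e)"
    by (intro compact_imp_bounded compact_continuous_image) auto
  then obtain B where B: "B > 0" "\<forall>x\<in>cball p e. norm (?g x) \<le> B"
    unfolding bounded_pos by (metis imageI)
  have on: "onorm (frechet_derivative F (at x)) \<le> B" if x: "x \<in> cball p e" for x
  proof (rule onorm_le)
    fix v
    have lin: "linear (frechet_derivative F (at x))"
      using diff x p by (intro linear_frechet_derivative) auto
    have "frechet_derivative F (at x) v = frechet_derivative F (at x) (\<Sum>b\<in>Basis. (v \<bullet> b) *\<^sub>R b)"
      by (simp add: euclidean_representation)
    also have "\<dots> = (\<Sum>b\<in>Basis. (v \<bullet> b) * frechet_derivative F (at x) b)"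
      by (simp add: linear_sum[OF lin] linear_scale[OF lin])
    also have "norm \<dots> \<le> (\<Sum>b\<in>Basis. norm v * \<bar>frechet_derivative F (at x) b\<bar>)"
      by (rule sum_norm_le) (auto simp: abs_mult intro!: mult_right_mono Basis_le_norm)
    also have "\<dots> = norm v * ?g x" by (simp add: sum_distrib_left)
    also have "\<dots> \<le> norm v * B" using bspec[OF B(2) x] by (intro mult_left_mono) auto
    finally show "norm (frechet_derivative F (at x) v) \<le> B * norm v" by (simp add: mult.commute)
  qed
  have "norm (F x - F y) \<le> B * norm (x - y)" if "x \<in> cball p e" "y \<in> cball p e" for x y
  proof (rule differentiable_bound[OF convex_cball[of p e] _ on _ _])
    fix x assume "x \<in> cball p e"
    then show "(F has_derivative frechet_derivative F (at x)) (at x within cball p e)"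
      using diff p by (auto intro!: has_derivative_at_withinI frechet_derivative_works[THEN iffD1])
  qed (use that in auto)
  then have "B-lipschitz_on (cball p e) F"
    using B(1) by (intro lipschitz_onI) (auto simp: dist_norm)
  then show ?thesis by (rule that)
qed

lemma smooth_on_sphere_lipschitz:
  fixes f :: "'a::euclidean_space \<Rightarrow> real"
  assumes f: "smooth_on_sphere f"
  obtains L where "L-lipschitz_on (sphere 0 1) f"
proof -
  have ll: "local_lipschitz {0::real} (sphere 0 1) (\<lambda>_. f)"
  proof (rule local_lipschitzI)
    fix x :: 'a assume "x \<in> sphere 0 1"
    then obtain U F where U: "open U" "x \<in> U" "smooth_on U F" "\<forall>y \<in> U \<inter> sphere 0 1. f y = F y"
      using f unfolding smooth_on_sphere_def by meson
    then obtain e where e: "e > 0" "cball x e \<subseteq> U" using open_contains_cball by blast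
    obtain L where "L-lipschitz_on (cball x e) F" by (rule smooth_on_locally_lipschitz[OF U(3) e(2)])
    then have "L-lipschitz_on (cball x e \<inter> sphere 0 1) F" by (rule lipschitz_on_subset) auto
    then have "L-lipschitz_on (cball x e \<inter> sphere 0 1) f"
      by (rule lipschitz_on_transform) (use U(4) e(2) in auto)
    then show "\<exists>u>0. \<exists>L. \<forall>t\<in>cball t u \<inter> {0}. L-lipschitz_on (cball x u \<inter> sphere 0 1) f" for t
      using e(1) by blast
  qed
  obtain L where "\<And>t. t \<in> {0::real} \<Longrightarrow> L-lipschitz_on (sphere 0 1) f"
    by (rule local_lipschitz_compact_implies_lipschitz[OF ll]) auto
  then show ?thesis using that by blast
qed

section \<open>Separated points in an orbit\<close>

text \<open>
  The points lie on a graph over a grid of mesh \<open>h\<close> in the hyperplane orthogonal to one coordinate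
  axis. Grid coordinates of size at most \<open>r / CARD('m)\<close> keep the grid inside the ball of radius \<open>r\<close>.
\<close>
lemma sphere_separated_points:
  fixes r h :: real
  assumes h: "0 < h" and r: "0 \<le> r"
  obtains P :: "(real^'m) set" where "finite P" "P \<subseteq> sphere 0 r"
    "\<And>p q. p \<in> P \<Longrightarrow> q \<in> P \<Longrightarrow> p \<noteq> q \<Longrightarrow> h \<le> dist p q"
    "(r / (h * CARD('m))) ^ (CARD('m) - 1) \<le> card P"
proof -
  obtain i0 :: 'm where "True" by blast
  define K where "K = nat \<lfloor>r / (h * CARD('m))\<rfloor>"
  define F where "F = PiE (UNIV - {i0}) (\<lambda>_. {..K})"
  define S where "S k = (\<Sum>j\<in>UNIV - {i0}. (h * real (k j))\<^sup>2)" for k :: "'m \<Rightarrow> nat"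
  define x :: "('m \<Rightarrow> nat) \<Rightarrow> real^'m" where
    "x k = (\<chi> i. if i = i0 then sqrt (r\<^sup>2 - S k) else h * real (k i))" for k
  have m: "real CARD('m) > 0" by simp
  have S: "S k \<le> r\<^sup>2" if k: "k \<in> F" for k
  proof -
    have "CARD('m) - 1 \<le> CARD('m)\<^sup>2" using self_le_power[of "CARD('m)" 2] by simp
    then have card_le: "real (CARD('m) - 1) \<le> (real CARD('m))\<^sup>2" by (simp flip: of_nat_power)
    have "S k \<le> (\<Sum>j\<in>UNIV - {i0}. (r / CARD('m))\<^sup>2)"
      unfolding S_def
    proof (intro sum_mono power_mono)
      fix j assume "j \<in> UNIV - {i0}"
      then have "real (k j) \<le> real K" using k by (auto simp: F_def PiE_def Pi_def)
      also have "\<dots> \<le> r / (h * CARD('m))" unfolding K_def using h r by (intro of_nat_floor) simp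
      finally have "h * real (k j) \<le> h * (r / (h * CARD('m)))" using h by (intro mult_left_mono) auto
      then show "h * real (k j) \<le> r / CARD('m)" using h by simp
    qed (use h in auto)
    also have "\<dots> = real (CARD('m) - 1) * (r / CARD('m))\<^sup>2" by (simp add: card_Diff_singleton)
    also have "\<dots> \<le> (real CARD('m))\<^sup>2 * (r / CARD('m))\<^sup>2"
      using card_le by (intro mult_right_mono) auto
    also have "\<dots> = r\<^sup>2" by (simp add: power_divide)
    finally show ?thesis .
  qed
  have norm_x: "norm (x k) = r" if k: "k \<in> F" for k
  proof -
    have "(norm (x k))\<^sup>2 = (\<Sum>i\<in>UNIV. (x k $ i)\<^sup>2)"
      by (simp add: norm_vec_def L2_set_def sum_nonneg)
    also have "\<dots> = (x k $ i0)\<^sup>2 + (\<Sum>i\<in>UNIV - {i0}. (x k $ i)\<^sup>2)"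
      by (rule sum.remove) auto
    also have "(\<Sum>i\<in>UNIV - {i0}. (x k $ i)\<^sup>2) = S k"
      unfolding S_def by (rule sum.cong) (auto simp: x_def)
    also have "(x k $ i0)\<^sup>2 + S k = r\<^sup>2" using S[OF k] by (simp add: x_def)
    finally show ?thesis using r by (simp add: power2_eq_iff_nonneg)
  qed
  have sep: "h \<le> dist (x k) (x l)" if kl: "k \<in> F" "l \<in> F" "k \<noteq> l" for k l
  proof -
    obtain i where i: "i \<noteq> i0" "k i \<noteq> l i"
      using PiE_ext[of k "UNIV - {i0}" _ l] kl unfolding F_def by blast
    have "h * 1 \<le> h * \<bar>real (k i) - real (l i)\<bar>" using h i(2) by (intro mult_left_mono) auto
    also have "\<dots> = \<bar>h * real (k i) - h * real (l i)\<bar>"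
      using h by (simp add: abs_mult flip: right_diff_distrib)
    also have "\<dots> = \<bar>(x k - x l) $ i\<bar>" using i(1) by (simp add: x_def)
    also have "\<dots> \<le> norm (x k - x l)" by (rule component_le_norm_cart)
    finally show ?thesis by (simp add: dist_norm)
  qed
  have inj: "inj_on x F"
  proof (rule inj_onI, rule ccontr)
    fix k l assume "k \<in> F" "l \<in> F" "x k = x l" "k \<noteq> l"
    then show False using sep[of k l] h by simp
  qed
  have "card F = (K + 1) ^ (CARD('m) - 1)"
    by (simp add: F_def card_PiE card_Diff_singleton)
  then have card: "card (x ` F) = (K + 1) ^ (CARD('m) - 1)" by (simp add: card_image[OF inj])
  show ?thesis
  proof (rule that[of "x ` F"])
    show "finite (x ` F)" by (simp add: F_def finite_PiE)
    show "x ` F \<subseteq> sphere 0 r" using norm_x by auto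
    show "h \<le> dist p q" if "p \<in> x ` F" "q \<in> x ` F" "p \<noteq> q" for p q
      using that sep by blast
    have "r / (h * CARD('m)) \<le> real (K + 1)" unfolding K_def by simp linarith
    then show "(r / (h * CARD('m))) ^ (CARD('m) - 1) \<le> card (x ` F)"
      unfolding card using r h by (simp add: power_mono)
  qed
qed

lemma block_act_orthogonal_transformation:
  assumes "\<gamma> \<in> block_orthogonal"
  shows "orthogonal_transformation (block_act \<gamma>)"
proof -
  obtain A B where \<gamma>: "\<gamma> = (A, B)" "orthogonal_matrix A" "orthogonal_matrix B"
    using assms by (auto simp: block_orthogonal_def)
  then have AB: "orthogonal_transformation ((*v) A)" "orthogonal_transformation ((*v) B)"
    by (auto simp: orthogonal_transformation_matrix)
  show ?thesis
    unfolding orthogonal_transformation_def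
  proof
    show "linear (block_act \<gamma>)"
      by (rule linearI) (auto simp: block_act_def matrix_vector_right_distrib matrix_vector_mult_scaleR)
    show "\<forall>v w. block_act \<gamma> v \<bullet> block_act \<gamma> w = v \<bullet> w"
      using AB by (auto simp: \<gamma> block_act_def inner_prod_def orthogonal_transformation_def)
  qed
qed

lemma orthogonal_matrix_exists:
  fixes a b :: "real^'n"
  assumes "norm a = norm b"
  shows "\<exists>A. orthogonal_matrix A \<and> A *v a = b"
proof -
  obtain f where "orthogonal_transformation f" "f a = b"
    using orthogonal_transformation_exists[OF assms] by blast
  then show ?thesis
    by (intro exI[of _ "matrix f"]) (simp add: orthogonal_transformation_matrix)
qed

lemma orbit_separated_points:
  fixes z :: "(real^'m) \<times> (real^'n)"
  assumes h: "0 < h"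
  obtains \<Gamma> where "finite \<Gamma>" "\<Gamma> \<subseteq> block_orthogonal"
    "\<And>\<gamma> \<gamma>'. \<gamma> \<in> \<Gamma> \<Longrightarrow> \<gamma>' \<in> \<Gamma> \<Longrightarrow> \<gamma> \<noteq> \<gamma>' \<Longrightarrow> h \<le> dist (block_act \<gamma> z) (block_act \<gamma>' z)"
    "(norm (fst z) / (h * CARD('m))) ^ (CARD('m) - 1) *
     (norm (snd z) / (h * CARD('n))) ^ (CARD('n) - 1) \<le> card \<Gamma>"
proof -
  obtain P :: "(real^'m) set" where P: "finite P" "P \<subseteq> sphere 0 (norm (fst z))"
    "\<And>p q. p \<in> P \<Longrightarrow> q \<in> P \<Longrightarrow> p \<noteq> q \<Longrightarrow> h \<le> dist p q"
    "(norm (fst z) / (h * CARD('m))) ^ (CARD('m) - 1) \<le> card P"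
    using sphere_separated_points[OF h norm_ge_zero] by blast
  obtain Q :: "(real^'n) set" where Q: "finite Q" "Q \<subseteq> sphere 0 (norm (snd z))"
    "\<And>p q. p \<in> Q \<Longrightarrow> q \<in> Q \<Longrightarrow> p \<noteq> q \<Longrightarrow> h \<le> dist p q"
    "(norm (snd z) / (h * CARD('n))) ^ (CARD('n) - 1) \<le> card Q"
    using sphere_separated_points[OF h norm_ge_zero] by blast
  have "\<exists>A. orthogonal_matrix A \<and> A *v fst z = p" if "p \<in> P" for p
  proof (rule orthogonal_matrix_exists)
    show "norm (fst z) = norm p" using P(2) that by auto
  qed
  then obtain A where A: "\<And>p. p \<in> P \<Longrightarrow> orthogonal_matrix (A p) \<and> A p *v fst z = p" by metis
  have "\<exists>B. orthogonal_matrix B \<and> B *v snd z = q" if "q \<in> Q" for q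
  proof (rule orthogonal_matrix_exists)
    show "norm (snd z) = norm q" using Q(2) that by auto
  qed
  then obtain B where B: "\<And>q. q \<in> Q \<Longrightarrow> orthogonal_matrix (B q) \<and> B q *v snd z = q" by metis
  let ?g = "\<lambda>(p, q). (A p, B q)"
  have inj: "inj_on ?g (P \<times> Q)"
    by (rule inj_onI) (use A B in \<open>clarsimp, metis\<close>)
  have act: "block_act (A p, B q) z = (p, q)" if "p \<in> P" "q \<in> Q" for p q
    using A B that by (simp add: block_act_def)
  show ?thesis
  proof (rule that[of "?g ` (P \<times> Q)"])
    show "finite (?g ` (P \<times> Q))" using P(1) Q(1) by simp
    show "?g ` (P \<times> Q) \<subseteq> block_orthogonal" using A B by (auto simp: block_orthogonal_def)
    show "h \<le> dist (block_act \<gamma> z) (block_act \<gamma>' z)"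
      if mem: "\<gamma> \<in> ?g ` (P \<times> Q)" "\<gamma>' \<in> ?g ` (P \<times> Q)" and neq: "\<gamma> \<noteq> \<gamma>'" for \<gamma> \<gamma>'
    proof -
      obtain p q where pq: "p \<in> P" "q \<in> Q" "\<gamma> = (A p, B q)"
        using mem(1) by auto
      obtain p' q' where pq': "p' \<in> P" "q' \<in> Q" "\<gamma>' = (A p', B q')"
        using mem(2) by auto
      then consider "p \<noteq> p'" | "q \<noteq> q'" using neq pq pq' by auto
      then show ?thesis
      proof cases
        case 1
        then have "h \<le> dist p p'" using P(3) pq pq' by blast
        also have "\<dots> \<le> dist (p, q) (p', q')" using dist_fst_le[of "(p, q)" "(p', q')"] by simp
        finally show ?thesis using act pq pq' by simp
      next
        case 2
        then have "h \<le> dist q q'" using Q(3) pq pq' by blast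
        also have "\<dots> \<le> dist (p, q) (p', q')" using dist_snd_le[of "(p, q)" "(p', q')"] by simp
        finally show ?thesis using act pq pq' by simp
      qed
    qed
    show "(norm (fst z) / (h * CARD('m))) ^ (CARD('m) - 1) *
     (norm (snd z) / (h * CARD('n))) ^ (CARD('n) - 1) \<le> card (?g ` (P \<times> Q))"
      using P(4) Q(4) h by (simp add: card_image[OF inj] card_cartesian_product mult_mono)
  qed
qed

section \<open>Means over sets of finite measure\<close>

lemma integral_le_nn_integral:
  fixes f :: "'b \<Rightarrow> real"
  assumes "integrable M f"
  shows "ennreal (\<integral>x. f x \<partial>M) \<le> (\<integral>\<^sup>+x. ennreal (f x) \<partial>M)"
proof -
  have fin: "(\<integral>\<^sup>+x. ennreal (f x) \<partial>M) < \<infinity>"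
    using assms by (auto simp: real_integrable_def top.not_eq_extremum)
  have "(\<integral>x. f x \<partial>M) \<le> enn2real (\<integral>\<^sup>+x. ennreal (f x) \<partial>M)"
    using real_lebesgue_integral_def[OF assms] by simp
  then have "ennreal (\<integral>x. f x \<partial>M) \<le> ennreal (enn2real (\<integral>\<^sup>+x. ennreal (f x) \<partial>M))"
    by (rule ennreal_leI)
  also have "\<dots> = (\<integral>\<^sup>+x. ennreal (f x) \<partial>M)" using fin by (simp add: ennreal_enn2real_if)
  finally show ?thesis .
qed

text \<open>The mean value of \<open>f\<close> over \<open>A\<close>; it is \<open>0\<close> if the measure of \<open>A\<close> is \<open>0\<close> or \<open>\<infinity>\<close>.\<close>
definition set_mean :: "'b measure \<Rightarrow> 'b set \<Rightarrow> ('b \<Rightarrow> real) \<Rightarrow> real" where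
  "set_mean M A f = (LINT x:A|M. f x) / measure M A"

text \<open>
  Jensen's inequality for the square, stated with a nonnegative integral so that \<open>f\<close> need not be
  square integrable.
\<close>
lemma (in finite_measure) set_mean_deviation:
  assumes A: "A \<in> sets M" "0 < measure M A" and f: "integrable M f"
  shows "ennreal ((set_mean M A f - c)\<^sup>2 * measure M A) \<le> (\<integral>\<^sup>+x\<in>A. ennreal ((f x - c)\<^sup>2) \<partial>M)"
proof -
  define t where "t = set_mean M A f - c"
  have fA: "integrable M (\<lambda>x. indicator A x * f x)"
    using integrable_mult_indicator[OF A(1) f] by simp
  have iA: "integrable M (\<lambda>x. indicator A x :: real)"
    using A(1) by (simp add: less_top[symmetric])
  \<comment> \<open>With \<open>t\<close> the deviation of the mean, \<open>(f - c)\<^sup>2 \<ge> 2 t (f - c) - t\<^sup>2\<close>, whose integral over \<open>A\<close> is \<open>t\<^sup>2\<close> times the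
    measure of \<open>A\<close>.\<close>
  define g where "g x = 2 * t * (indicator A x * f x) - (2 * t * c + t\<^sup>2) * indicator A x" for x
  have g: "integrable M g"
    unfolding g_def using fA iA by (intro Bochner_Integration.integrable_diff integrable_mult_right)
  have "(\<integral>x. indicator A x * f x \<partial>M) = set_mean M A f * measure M A"
    using A(2) by (simp add: set_mean_def set_lebesgue_integral_def)
  then have "(\<integral>x. g x \<partial>M) = 2 * t * (set_mean M A f * measure M A) - (2 * t * c + t\<^sup>2) * measure M A"
    unfolding g_def using fA iA A(1) by (subst Bochner_Integration.integral_diff) auto
  also have "\<dots> = t\<^sup>2 * measure M A" by (simp add: t_def power2_eq_square algebra_simps)
  finally have "ennreal (t\<^sup>2 * measure M A) \<le> (\<integral>\<^sup>+x. ennreal (g x) \<partial>M)"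
    using integral_le_nn_integral[OF g] by simp
  also have "\<dots> \<le> (\<integral>\<^sup>+x\<in>A. ennreal ((f x - c)\<^sup>2) \<partial>M)"
  proof (rule nn_integral_mono)
    fix x
    have "2 * t * f x - (2 * t * c + t\<^sup>2) \<le> (f x - c)\<^sup>2"
      using zero_le_power2[of "f x - c - t"] by (simp add: power2_eq_square algebra_simps)
    then show "ennreal (g x) \<le> ennreal ((f x - c)\<^sup>2) * indicator A x"
      by (auto simp: g_def indicator_def intro!: ennreal_leI)
  qed
  finally show ?thesis by (simp add: t_def)
qed

lemma (in finite_measure) set_mean_difference:
  assumes A: "A \<in> sets M" "0 < measure M A" and B: "B \<in> sets M" "0 < measure M B"
    and f: "integrable M f"
  shows "ennreal ((set_mean M A f - set_mean M B f)\<^sup>2 * (measure M A * measure M B))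
    \<le> (\<integral>\<^sup>+x\<in>A. (\<integral>\<^sup>+y\<in>B. ennreal ((f x - f y)\<^sup>2) \<partial>M) \<partial>M)"
proof -
  have [measurable]: "f \<in> borel_measurable M" "A \<in> sets M" using f A(1) by auto
  have "ennreal ((set_mean M A f - set_mean M B f)\<^sup>2 * (measure M A * measure M B))
      = ennreal ((set_mean M A f - set_mean M B f)\<^sup>2 * measure M A) * ennreal (measure M B)"
    by (simp add: ennreal_mult mult.assoc)
  also have "\<dots> \<le> (\<integral>\<^sup>+x\<in>A. ennreal ((f x - set_mean M B f)\<^sup>2) \<partial>M) * ennreal (measure M B)"
    by (intro mult_right_mono set_mean_deviation A f) auto
  also have "\<dots> = (\<integral>\<^sup>+x. ennreal ((f x - set_mean M B f)\<^sup>2) * indicator A x * ennreal (measure M B) \<partial>M)"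
    by (intro nn_integral_multc[symmetric]) measurable
  also have "\<dots> \<le> (\<integral>\<^sup>+x\<in>A. (\<integral>\<^sup>+y\<in>B. ennreal ((f x - f y)\<^sup>2) \<partial>M) \<partial>M)"
  proof (rule nn_integral_mono)
    fix x
    have "ennreal ((f x - set_mean M B f)\<^sup>2) * ennreal (measure M B)
        = ennreal ((set_mean M B f - f x)\<^sup>2 * measure M B)"
      by (simp add: ennreal_mult power2_commute)
    also have "\<dots> \<le> (\<integral>\<^sup>+y\<in>B. ennreal ((f y - f x)\<^sup>2) \<partial>M)"
      by (rule set_mean_deviation[OF B f])
    finally show "ennreal ((f x - set_mean M B f)\<^sup>2) * indicator A x * ennreal (measure M B)
        \<le> (\<integral>\<^sup>+y\<in>B. ennreal ((f x - f y)\<^sup>2) \<partial>M) * indicator A x"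
      by (auto simp: indicator_def power2_commute)
  qed
  finally show ?thesis .
qed

section \<open>Oscillation over caps and the Gagliardo energy\<close>

text \<open>The spherical cap of chordal radius \<open>h\<close> around \<open>z\<close>.\<close>
definition cap :: "'a::euclidean_space \<Rightarrow> real \<Rightarrow> 'a set" where
  "cap z h = ball z h \<inter> sphere 0 1"

lemma cap_sets [measurable, simp]: "cap z h \<in> sets (borel_sphere_volume :: 'a::euclidean_space measure)"
  by (simp add: cap_def sets_borel_sphere_volume_iff)

text \<open>The mean value of \<open>u\<close> over a cap.\<close>
definition cap_mean :: "('a::euclidean_space \<Rightarrow> real) \<Rightarrow> real \<Rightarrow> 'a \<Rightarrow> real" where
  "cap_mean u h z = set_mean borel_sphere_volume (cap z h) u"

text \<open>The unnormalized mean square oscillation of \<open>u\<close> between two caps.\<close>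
definition cap_osc :: "('a::euclidean_space \<Rightarrow> real) \<Rightarrow> 'a \<Rightarrow> real \<Rightarrow> 'a \<Rightarrow> real \<Rightarrow> ennreal" where
  "cap_osc u z h z' h' =
     (\<integral>\<^sup>+a\<in>cap z h. (\<integral>\<^sup>+b\<in>cap z' h'. ennreal ((u a - u b)\<^sup>2) \<partial>borel_sphere_volume) \<partial>borel_sphere_volume)"

text \<open>
  The integrand of the Gagliardo energy with exponent \<open>q\<close>. On the diagonal it is \<open>0\<close>, because \<open>0 / 0 = 0\<close>.
\<close>
definition gagliardo :: "real \<Rightarrow> ('a::real_normed_vector \<Rightarrow> real) \<Rightarrow> 'a \<Rightarrow> 'a \<Rightarrow> ennreal" where
  "gagliardo q w a b = ennreal (\<bar>w a - w b\<bar>\<^sup>2 / norm (a - b) powr q)"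

lemma ennreal_mult_add:
  "0 \<le> x \<Longrightarrow> 0 \<le> y \<Longrightarrow> 0 \<le> z \<Longrightarrow> ennreal (x * y + z) = ennreal x * ennreal y + ennreal z"
  by (simp add: ennreal_plus ennreal_mult)

text \<open>
  At distance at most \<open>\<rho>\<close>, the increments of \<open>u\<close> are controlled by the energy density of \<open>u - \<phi>\<close> and the
  Lipschitz constant of \<open>\<phi>\<close>.
\<close>
lemma square_difference_bound:
  fixes u \<phi> :: "'a::real_normed_vector \<Rightarrow> real"
  assumes L: "L-lipschitz_on X \<phi>" and ab: "a \<in> X" "b \<in> X" "norm (a - b) \<le> \<rho>" and q: "0 \<le> q"
  shows "ennreal ((u a - u b)\<^sup>2)
    \<le> ennreal (2 * \<rho> powr q) * gagliardo q (\<lambda>x. u x - \<phi> x) a b + ennreal (2 * L\<^sup>2 * \<rho>\<^sup>2)"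
proof -
  define w where "w x = u x - \<phi> x" for x
  have \<rho>: "0 \<le> \<rho>" using ab(3) norm_ge_zero order_trans by blast
  have L0: "0 \<le> L" using L by (rule lipschitz_on_nonneg)
  have w: "(w a - w b)\<^sup>2 \<le> \<rho> powr q * (\<bar>w a - w b\<bar>\<^sup>2 / norm (a - b) powr q)"
  proof (cases "a = b")
    case False
    then have "1 \<le> \<rho> powr q / norm (a - b) powr q"
      using ab(3) q by (simp add: powr_mono2)
    then have "\<bar>w a - w b\<bar>\<^sup>2 * 1 \<le> \<bar>w a - w b\<bar>\<^sup>2 * (\<rho> powr q / norm (a - b) powr q)"
      by (intro mult_left_mono) auto
    then show ?thesis by (simp add: mult_ac)
  qed simp
  have "\<bar>\<phi> a - \<phi> b\<bar> \<le> L * norm (a - b)"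
    using lipschitz_onD[OF L ab(1,2)] by (simp add: dist_norm)
  also have "\<dots> \<le> L * \<rho>" using ab(3) L0 by (rule mult_left_mono)
  finally have "\<bar>\<phi> a - \<phi> b\<bar>\<^sup>2 \<le> (L * \<rho>)\<^sup>2" by (rule power_mono) simp
  then have \<phi>: "(\<phi> a - \<phi> b)\<^sup>2 \<le> L\<^sup>2 * \<rho>\<^sup>2" by (simp add: power_mult_distrib)
  have "(u a - u b)\<^sup>2 = ((w a - w b) + (\<phi> a - \<phi> b))\<^sup>2" by (simp add: w_def)
  also have "\<dots> \<le> 2 * (w a - w b)\<^sup>2 + 2 * (\<phi> a - \<phi> b)\<^sup>2"
    using sum_squares_bound[of "w a - w b" "\<phi> a - \<phi> b"] by (simp add: power2_sum)
  also have "\<dots> \<le> 2 * \<rho> powr q * (\<bar>w a - w b\<bar>\<^sup>2 / norm (a - b) powr q) + 2 * L\<^sup>2 * \<rho>\<^sup>2"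
    using w \<phi> by linarith
  finally have "ennreal ((u a - u b)\<^sup>2)
    \<le> ennreal (2 * \<rho> powr q * (\<bar>w a - w b\<bar>\<^sup>2 / norm (a - b) powr q) + 2 * L\<^sup>2 * \<rho>\<^sup>2)"
    by (rule ennreal_leI)
  then show ?thesis
    using \<rho> by (subst (asm) ennreal_mult_add) (auto simp: gagliardo_def w_def)
qed

lemma gagliardo_measurable [measurable]:
  fixes w :: "'a::euclidean_space \<Rightarrow> real"
  assumes [measurable]: "w \<in> borel_measurable M" "(\<lambda>x. x) \<in> borel_measurable M"
  shows "case_prod (gagliardo q w) \<in> borel_measurable (M \<Otimes>\<^sub>M M)"
proof -
  have [measurable]: "(\<lambda>p. fst p) \<in> M \<Otimes>\<^sub>M M \<rightarrow>\<^sub>M borel" "(\<lambda>p. snd p) \<in> M \<Otimes>\<^sub>M M \<rightarrow>\<^sub>M borel"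
    using measurable_compose[OF measurable_fst assms(2)] measurable_compose[OF measurable_snd assms(2)] by auto
  show ?thesis
    unfolding gagliardo_def case_prod_beta by measurable
qed

lemma lipschitz_measurable_sphere:
  assumes "L-lipschitz_on (sphere 0 1) f"
  shows "f \<in> borel_measurable borel_sphere_volume"
proof -
  have "f \<in> borel_measurable (restrict_space borel (sphere 0 1))"
    by (intro borel_measurable_continuous_on_restrict lipschitz_on_continuous_on[OF assms])
  then show ?thesis by (subst measurable_cong_sets[OF sets_borel_sphere_volume refl])
qed

lemma cap_orthogonal_vimage:
  fixes T :: "'a::euclidean_space \<Rightarrow> 'a"
  assumes "orthogonal_transformation T"
  shows "T a \<in> cap (T z) h \<longleftrightarrow> a \<in> cap z h"
  using assms orthogonal_transformation_norm[OF assms, of a]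
  by (simp add: cap_def orthogonal_transformation_dist)

lemma measure_cap_orthogonal:
  fixes T :: "'a::euclidean_space \<Rightarrow> 'a"
  assumes T: "orthogonal_transformation T"
  shows "measure borel_sphere_volume (cap (T z) h) = measure borel_sphere_volume (cap z h)"
proof -
  have "emeasure borel_sphere_volume (cap (T z) h)
      = emeasure (distr borel_sphere_volume borel_sphere_volume T) (cap (T z) h)"
    by (simp add: distr_borel_sphere_volume_orthogonal(2)[OF T])
  also have "\<dots> = emeasure borel_sphere_volume (T -` cap (T z) h \<inter> sphere 0 1)"
    by (subst emeasure_distr) (auto intro: distr_borel_sphere_volume_orthogonal(1)[OF T])
  also have "T -` cap (T z) h \<inter> sphere 0 1 = cap z h"
    using cap_orthogonal_vimage[OF T, of _ z h] by (auto simp: cap_def orthogonal_transformation_norm[OF T] orthogonal_transformation_dist[OF T])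
  finally show ?thesis by (simp add: measure_def)
qed

lemma cap_osc_orthogonal:
  fixes T :: "'a::euclidean_space \<Rightarrow> 'a"
  assumes T: "orthogonal_transformation T"
    and u [measurable]: "u \<in> borel_measurable borel_sphere_volume"
    and inv: "AE a in borel_sphere_volume. u (T a) = u a"
  shows "cap_osc u (T z) h (T z') h' = cap_osc u z h z' h'"
proof -
  interpret finite_measure "borel_sphere_volume :: 'a measure" by (rule finite_borel_sphere_volume)
  let ?S = "borel_sphere_volume :: 'a measure"
  note T_meas [measurable] = distr_borel_sphere_volume_orthogonal(1)[OF T]
  have change: "(\<integral>\<^sup>+a. f a \<partial>?S) = (\<integral>\<^sup>+a. f (T a) \<partial>?S)" if "f \<in> borel_measurable ?S" for f
    using nn_integral_distr[OF T_meas, of f] that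
    by (simp add: distr_borel_sphere_volume_orthogonal(2)[OF T])
  have ind: "indicator (cap (T y) r) (T a) = (indicator (cap y r) a :: ennreal)" for y a r
    using cap_orthogonal_vimage[OF T] by (simp add: indicator_def)
  have inner: "(\<integral>\<^sup>+b\<in>cap (T z') h'. ennreal ((x - u b)\<^sup>2) \<partial>?S)
      = (\<integral>\<^sup>+b\<in>cap z' h'. ennreal ((x - u b)\<^sup>2) \<partial>?S)" for x
    using inv by (subst change) (auto simp: ind intro!: nn_integral_cong_AE)
  show ?thesis
    unfolding cap_osc_def inner
    using inv by (subst change) (auto simp: ind intro!: nn_integral_cong_AE)
qed

text \<open>
  The packing argument: the oscillation between two nearby caps is the same at all points \<open>T i z\<close>, and
  near these points the energies of \<open>u - \<phi>\<close> live on disjoint caps of radius \<open>2 h\<close>, so that together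
  they do not exceed the total energy \<open>E\<close>.
\<close>
lemma card_times_cap_osc_le:
  fixes u \<phi> :: "'a::euclidean_space \<Rightarrow> real"
  assumes u [measurable]: "u \<in> borel_measurable borel_sphere_volume"
    and L: "L-lipschitz_on (sphere 0 1) \<phi>"
    and E: "(\<integral>\<^sup>+a. (\<integral>\<^sup>+b. gagliardo q (\<lambda>x. u x - \<phi> x) a b \<partial>borel_sphere_volume) \<partial>borel_sphere_volume) \<le> ennreal E"
      "0 \<le> E" "0 \<le> q"
    and I: "finite I" "\<And>i. i \<in> I \<Longrightarrow> orthogonal_transformation (T i)"
      "\<And>i. i \<in> I \<Longrightarrow> AE a in borel_sphere_volume. u (T i a) = u a"
      "\<And>i j. i \<in> I \<Longrightarrow> j \<in> I \<Longrightarrow> i \<noteq> j \<Longrightarrow> 4 * h \<le> dist (T i z) (T j z)"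
    and h: "0 < h" "h' \<le> h" "dist z z' \<le> h"
  shows "of_nat (card I) * cap_osc u z h z' h' \<le>
    ennreal (2 * (4 * h) powr q * E +
      card I * (32 * L\<^sup>2 * h\<^sup>2 * (measure borel_sphere_volume (cap z h) * measure borel_sphere_volume (cap z' h'))))"
proof -
  interpret finite_measure "borel_sphere_volume :: 'a measure" by (rule finite_borel_sphere_volume)
  let ?S = "borel_sphere_volume :: 'a measure"
  let ?m = "\<lambda>z h. measure ?S (cap z h)"
  let ?w = "\<lambda>x. u x - \<phi> x"
  have [measurable]: "\<phi> \<in> borel_measurable ?S" by (rule lipschitz_measurable_sphere[OF L])
  define D where "D a = (\<integral>\<^sup>+b. gagliardo q ?w a b \<partial>?S)" for a
  have [measurable]: "D \<in> borel_measurable ?S" unfolding D_def by measurable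
  have gmp: "case_prod (gagliardo q ?w) \<in> borel_measurable (?S \<Otimes>\<^sub>M ?S)" by measurable
  have gm [measurable]: "gagliardo q ?w a \<in> borel_measurable ?S" if "a \<in> space ?S" for a
    using measurable_Pair2[OF gmp that] by simp
  have one: "cap_osc u z h z' h' \<le>
      ennreal (2 * (4 * h) powr q) * (\<integral>\<^sup>+a\<in>cap (T i z) (2 * h). D a \<partial>?S)
      + ennreal (32 * L\<^sup>2 * h\<^sup>2 * (?m z h * ?m z' h'))" if i: "i \<in> I" for i
  proof -
    note Ti = I(2)[OF i]
    have dT: "dist (T i z) (T i z') \<le> h"
      using Ti h(3) by (simp add: orthogonal_transformation_dist)
    let ?C = "ennreal (2 * (4 * h) powr q)" and ?R = "ennreal (32 * L\<^sup>2 * h\<^sup>2)"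
    have "cap_osc u z h z' h' = cap_osc u (T i z) h (T i z') h'"
      using cap_osc_orthogonal[OF Ti u I(3)[OF i]] by simp
    also have "\<dots> \<le> (\<integral>\<^sup>+a. ?C * (D a * indicator (cap (T i z) (2 * h)) a)
        + ?R * ?m z' h' * indicator (cap (T i z) h) a \<partial>?S)"
      unfolding cap_osc_def
    proof (rule nn_integral_mono)
      fix a assume a: "a \<in> space ?S"
      show "(\<integral>\<^sup>+b\<in>cap (T i z') h'. ennreal ((u a - u b)\<^sup>2) \<partial>?S) * indicator (cap (T i z) h) a
          \<le> ?C * (D a * indicator (cap (T i z) (2 * h)) a) + ?R * ?m z' h' * indicator (cap (T i z) h) a"
      proof (cases "a \<in> cap (T i z) h")
        case True
        then have a2: "a \<in> cap (T i z) (2 * h)" using h(1) by (auto simp: cap_def)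
        have "(\<integral>\<^sup>+b\<in>cap (T i z') h'. ennreal ((u a - u b)\<^sup>2) \<partial>?S)
            \<le> (\<integral>\<^sup>+b. ?C * gagliardo q ?w a b + ?R * indicator (cap (T i z') h') b \<partial>?S)"
        proof (rule nn_integral_mono)
          fix b assume b: "b \<in> space ?S"
          show "ennreal ((u a - u b)\<^sup>2) * indicator (cap (T i z') h') b
              \<le> ?C * gagliardo q ?w a b + ?R * indicator (cap (T i z') h') b"
          proof (cases "b \<in> cap (T i z') h'")
            case b': True
            have "dist a b \<le> dist a (T i z) + dist (T i z) (T i z') + dist (T i z') b"
              by (metric)
            also have "\<dots> \<le> 4 * h" using True b' dT h by (auto simp: cap_def dist_commute)
            finally have "norm (a - b) \<le> 4 * h" by (simp add: dist_norm)
            then show ?thesis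
              using square_difference_bound[where a=a and b=b and u=u and \<rho>="4 * h", OF L _ _ _ E(3)] a b b'
              by (simp add: power_mult_distrib mult.assoc)
          qed simp
        qed
        also have "\<dots> = ?C * D a + ?R * ?m z' h'"
          using a gm[OF a] by (simp add: nn_integral_add nn_integral_cmult D_def emeasure_eq_measure
              measure_cap_orthogonal[OF Ti])
        finally show ?thesis using True a2 by simp
      qed simp
    qed
    also have "\<dots> = ?C * (\<integral>\<^sup>+a\<in>cap (T i z) (2 * h). D a \<partial>?S) + ?R * ?m z' h' * ?m z h"
      by (simp add: nn_integral_add nn_integral_cmult emeasure_eq_measure measure_cap_orthogonal[OF Ti])
    finally show ?thesis by (simp add: ennreal_mult mult_ac)
  qed
  have disj: "(\<Sum>i\<in>I. D a * indicator (cap (T i z) (2 * h)) a) \<le> D a" for a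
  proof (cases "\<exists>i\<in>I. a \<in> cap (T i z) (2 * h)")
    case True
    then obtain i where i: "i \<in> I" "a \<in> cap (T i z) (2 * h)" by blast
    have "a \<notin> cap (T j z) (2 * h)" if "j \<in> I - {i}" for j
    proof
      assume "a \<in> cap (T j z) (2 * h)"
      then have "dist (T i z) (T j z) < 4 * h"
        using i(2) dist_triangle2[of "T i z" "T j z" a] by (auto simp: cap_def)
      then show False using I(4)[of i j] i(1) that by auto
    qed
    then have "(\<Sum>j\<in>I - {i}. D a * indicator (cap (T j z) (2 * h)) a) = 0"
      by (intro sum.neutral) simp
    moreover have "(\<Sum>j\<in>I. D a * indicator (cap (T j z) (2 * h)) a)
        = D a * indicator (cap (T i z) (2 * h)) a + (\<Sum>j\<in>I - {i}. D a * indicator (cap (T j z) (2 * h)) a)"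
      using I(1) i(1) by (rule sum.remove)
    ultimately show ?thesis using i by simp
  qed simp
  have "of_nat (card I) * cap_osc u z h z' h' = (\<Sum>i\<in>I. cap_osc u z h z' h')" by simp
  also have "\<dots> \<le> (\<Sum>i\<in>I. ennreal (2 * (4 * h) powr q) * (\<integral>\<^sup>+a\<in>cap (T i z) (2 * h). D a \<partial>?S)
      + ennreal (32 * L\<^sup>2 * h\<^sup>2 * (?m z h * ?m z' h')))"
    by (intro sum_mono one)
  also have "\<dots> = ennreal (2 * (4 * h) powr q) * (\<integral>\<^sup>+a. (\<Sum>i\<in>I. D a * indicator (cap (T i z) (2 * h)) a) \<partial>?S)
      + of_nat (card I) * ennreal (32 * L\<^sup>2 * h\<^sup>2 * (?m z h * ?m z' h'))"
    by (subst nn_integral_sum) (simp_all add: sum.distrib sum_distrib_left)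
  also have "\<dots> \<le> ennreal (2 * (4 * h) powr q) * ennreal E
      + of_nat (card I) * ennreal (32 * L\<^sup>2 * h\<^sup>2 * (?m z h * ?m z' h'))"
  proof (intro add_right_mono mult_left_mono)
    have "(\<integral>\<^sup>+a. (\<Sum>i\<in>I. D a * indicator (cap (T i z) (2 * h)) a) \<partial>?S) \<le> (\<integral>\<^sup>+a. D a \<partial>?S)"
      by (rule nn_integral_mono) (rule disj)
    also have "\<dots> \<le> ennreal E" using E(1) by (simp add: D_def)
    finally show "(\<integral>\<^sup>+a. (\<Sum>i\<in>I. D a * indicator (cap (T i z) (2 * h)) a) \<partial>?S) \<le> ennreal E" .
  qed simp
  also have "\<dots> = ennreal (2 * (4 * h) powr q * E + card I * (32 * L\<^sup>2 * h\<^sup>2 * (?m z h * ?m z' h')))"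
    using E(2) by (simp add: ennreal_plus ennreal_mult ennreal_of_nat_eq_real_of_nat)
  finally show ?thesis .
qed

section \<open>Estimates for cap means\<close>

text \<open>
  The convergence holds at every point where the inner energy integral is finite, thus no Lebesgue
  differentiation theorem is needed.
\<close>
lemma cap_mean_converges_AE:
  fixes u \<phi> :: "'a::euclidean_space \<Rightarrow> real"
  assumes u [measurable]: "u \<in> borel_measurable borel_sphere_volume"
    and int: "integrable borel_sphere_volume u"
    and L: "L-lipschitz_on (sphere 0 1) \<phi>"
    and E: "(\<integral>\<^sup>+a. (\<integral>\<^sup>+b. gagliardo q (\<lambda>x. u x - \<phi> x) a b \<partial>borel_sphere_volume) \<partial>borel_sphere_volume) < \<infinity>"
    and q: "real (DIM('a) - 1) < q"
  shows "AE z in borel_sphere_volume. (\<lambda>k. cap_mean u ((1/2) ^ k) z) \<longlonglongrightarrow> u z"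
proof -
  interpret finite_measure "borel_sphere_volume :: 'a measure" by (rule finite_borel_sphere_volume)
  let ?S = "borel_sphere_volume :: 'a measure"
  let ?w = "\<lambda>x. u x - \<phi> x"
  define c where "c = DIM('a) * measure lborel (ball (0::'a) (1/8))"
  have c: "c > 0" unfolding c_def using content_ball_pos[of "1/8" "0::'a"] by simp
  have [measurable]: "\<phi> \<in> borel_measurable ?S" by (rule lipschitz_measurable_sphere[OF L])
  define D where "D a = (\<integral>\<^sup>+b. gagliardo q ?w a b \<partial>?S)" for a
  have gmp: "case_prod (gagliardo q ?w) \<in> borel_measurable (?S \<Otimes>\<^sub>M ?S)" by measurable
  have gm [measurable]: "gagliardo q ?w a \<in> borel_measurable ?S" if "a \<in> space ?S" for a
    using measurable_Pair2[OF gmp that] by simp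
  have [measurable]: "D \<in> borel_measurable ?S" unfolding D_def by measurable
  have "AE z in ?S. D z \<noteq> \<infinity>"
    using E by (intro nn_integral_PInf_AE) (auto simp: D_def)
  then show ?thesis
  proof (rule AE_mp, intro AE_I2 impI)
    fix z assume z: "z \<in> space ?S" and "D z \<noteq> \<infinity>"
    then obtain d where d: "D z = ennreal d" "d \<ge> 0" by (cases "D z") auto
    have bound: "(cap_mean u h z - u z)\<^sup>2 \<le> 2 * d / c * h powr (q - real (DIM('a) - 1)) + 2 * L\<^sup>2 * h\<^sup>2"
      if h: "0 < h" "h \<le> 1" for h
    proof -
      define m where "m = measure ?S (cap z h)"
      have m: "c * h ^ (DIM('a) - 1) \<le> m"
        using cap_volume_lower_bound[of z h] z h by (simp add: m_def c_def cap_def)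
      have m0: "0 < m" using m c h by (smt (verit) mult_pos_pos zero_less_power)
      have "ennreal ((cap_mean u h z - u z)\<^sup>2 * m) \<le> (\<integral>\<^sup>+b\<in>cap z h. ennreal ((u b - u z)\<^sup>2) \<partial>?S)"
        unfolding cap_mean_def m_def using m0 int by (intro set_mean_deviation) (auto simp: m_def)
      also have "\<dots> \<le> (\<integral>\<^sup>+b. ennreal (2 * h powr q) * gagliardo q ?w z b
          + ennreal (2 * L\<^sup>2 * h\<^sup>2) * indicator (cap z h) b \<partial>?S)"
      proof (rule nn_integral_mono)
        fix b assume b: "b \<in> space ?S"
        show "ennreal ((u b - u z)\<^sup>2) * indicator (cap z h) b
            \<le> ennreal (2 * h powr q) * gagliardo q ?w z b + ennreal (2 * L\<^sup>2 * h\<^sup>2) * indicator (cap z h) b"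
        proof (cases "b \<in> cap z h")
          case True
          then have "norm (z - b) \<le> h" by (auto simp: cap_def dist_norm)
          then show ?thesis
            using square_difference_bound[where a=z and b=b and u=u and \<rho>=h, OF L, of q] z b True q
            by (simp add: power2_commute[of "u b"])
        qed simp
      qed
      also have "\<dots> = ennreal (2 * h powr q) * D z + ennreal (2 * L\<^sup>2 * h\<^sup>2) * ennreal m"
        using gm[OF z] by (simp add: nn_integral_add nn_integral_cmult D_def emeasure_eq_measure m_def)
      also have "\<dots> = ennreal (2 * h powr q * d + 2 * L\<^sup>2 * h\<^sup>2 * m)"
        using d m0 by (simp add: ennreal_plus ennreal_mult)
      finally have "(cap_mean u h z - u z)\<^sup>2 * m \<le> 2 * h powr q * d + 2 * L\<^sup>2 * h\<^sup>2 * m"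
        using d m0 by (subst (asm) ennreal_le_iff) auto
      then have "(cap_mean u h z - u z)\<^sup>2 \<le> 2 * h powr q * d / m + 2 * L\<^sup>2 * h\<^sup>2"
        using m0 by (simp add: field_simps)
      also have "2 * h powr q * d / m \<le> 2 * h powr q * d / (c * h ^ (DIM('a) - 1))"
        using m m0 c h d by (intro divide_left_mono mult_pos_pos zero_less_power) auto
      also have "\<dots> = 2 * d / c * h powr (q - real (DIM('a) - 1))"
        by (simp only: powr_diff powr_realpow[OF h(1)]) simp
      finally show ?thesis by simp
    qed
    define a where "a = q - real (DIM('a) - 1)"
    have "((\<lambda>h. 2 * d / c * h powr a + 2 * L\<^sup>2 * h\<^sup>2) \<longlongrightarrow> 2 * d / c * 0 powr a + 2 * L\<^sup>2 * 0\<^sup>2) (at_right 0)"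
      using q by (intro tendsto_intros tendsto_powr') (auto simp: a_def intro: eventually_mono[OF eventually_at_right_less])
    moreover have "filterlim (\<lambda>k. (1/2::real) ^ k) (at_right 0) sequentially"
      by (auto simp: filterlim_at LIMSEQ_realpow_zero)
    ultimately have lim: "(\<lambda>k. 2 * d / c * ((1/2) ^ k) powr a + 2 * L\<^sup>2 * ((1/2) ^ k)\<^sup>2) \<longlonglongrightarrow> 0"
      by (auto dest: filterlim_compose)
    have le: "(cap_mean u ((1/2) ^ k) z - u z)\<^sup>2
        \<le> 2 * d / c * ((1/2) ^ k) powr a + 2 * L\<^sup>2 * ((1/2) ^ k)\<^sup>2" for k
      unfolding a_def by (rule bound) (simp_all add: power_le_one)
    have "(\<lambda>k. (cap_mean u ((1/2) ^ k) z - u z)\<^sup>2) \<longlonglongrightarrow> 0"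
    proof (rule tendsto_sandwich[OF _ _ tendsto_const lim])
      show "\<forall>\<^sub>F k in sequentially. (cap_mean u ((1/2) ^ k) z - u z)\<^sup>2
          \<le> 2 * d / c * ((1/2) ^ k) powr a + 2 * L\<^sup>2 * ((1/2) ^ k)\<^sup>2"
        using le by (rule always_eventually[OF allI])
    qed simp
    then have "(\<lambda>k. cap_mean u ((1/2) ^ k) z - u z) \<longlonglongrightarrow> 0"
      using tendsto_real_sqrt by (fastforce simp: tendsto_rabs_zero_iff)
    then show "(\<lambda>k. cap_mean u ((1/2) ^ k) z) \<longlonglongrightarrow> u z"
      by (simp add: LIM_zero_iff)
  qed
qed

text \<open>
  The exponent \<open>2 s - 1\<close> is that of a one-dimensional fractional Sobolev function: the orbits have
  codimension \<open>1\<close> in the sphere. The constant degenerates as \<open>\<delta>\<close> tends to \<open>0\<close>, since one of the two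
  spherical factors of the orbit collapses at the singular set.
\<close>
lemma cap_mean_holder_estimate:
  fixes u \<phi> :: "(real^'m) \<times> (real^'n) \<Rightarrow> real"
  assumes N: "CARD('m) + CARD('n) = N + 1" and s: "1/2 < s" "s < 1"
    and u [measurable]: "u \<in> borel_measurable borel_sphere_volume"
    and int: "integrable borel_sphere_volume u"
    and inv: "\<forall>\<gamma>\<in>block_orthogonal. AE z in borel_sphere_volume. u (block_act \<gamma> z) = u z"
    and L: "L-lipschitz_on (sphere 0 1) \<phi>"
    and E: "(\<integral>\<^sup>+a. (\<integral>\<^sup>+b. gagliardo (real N + 2 * s) (\<lambda>x. u x - \<phi> x) a b \<partial>borel_sphere_volume) \<partial>borel_sphere_volume) < \<infinity>"
    and \<delta>: "0 < \<delta>"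
  obtains K where "0 \<le> K"
    "\<And>z z' h h'. \<lbrakk>z \<in> sphere 0 1; z' \<in> sphere 0 1; \<delta> \<le> norm (fst z); \<delta> \<le> norm (snd z);
      0 < h; h \<le> 1; h / 2 \<le> h'; h' \<le> h; dist z z' \<le> h\<rbrakk>
     \<Longrightarrow> (cap_mean u h z - cap_mean u h' z')\<^sup>2 \<le> K * h powr (2 * s - 1)"
proof -
  let ?S = "borel_sphere_volume :: ((real^'m) \<times> (real^'n)) measure"
  interpret finite_measure ?S by (rule finite_borel_sphere_volume)
  define q where "q = real N + 2 * s"
  obtain e where e: "(\<integral>\<^sup>+a. (\<integral>\<^sup>+b. gagliardo q (\<lambda>x. u x - \<phi> x) a b \<partial>?S) \<partial>?S) \<le> ennreal e" "0 \<le> e"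
    using E unfolding q_def
    by (cases "\<integral>\<^sup>+a. (\<integral>\<^sup>+b. gagliardo (real N + 2 * s) (\<lambda>x. u x - \<phi> x) a b \<partial>?S) \<partial>?S") auto
  define c where "c = DIM((real^'m) \<times> (real^'n)) * measure lborel (ball (0::(real^'m) \<times> (real^'n)) (1/8))"
  have c: "c > 0" unfolding c_def 
  proof (intro mult_pos_pos content_ball_pos)
    show "0 < real DIM((real^'m) \<times> (real^'n))" unfolding of_nat_0_less_iff by (rule DIM_positive)
  qed simp
  have dim: "DIM((real^'m) \<times> (real^'n)) - 1 = N" using N by simp
  have N1: "(CARD('m) - 1) + (CARD('n) - 1) = N - 1" "1 \<le> N"
    using N zero_less_card_finite[where 'a='m] zero_less_card_finite[where 'a='n] by linarith+
  define \<kappa> where "\<kappa> = (\<delta> / (4 * CARD('m))) ^ (CARD('m) - 1) * (\<delta> / (4 * CARD('n))) ^ (CARD('n) - 1)"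
  have \<kappa>: "0 < \<kappa>" using \<delta> by (simp add: \<kappa>_def)
  define K where "K = 2 * 4 powr q * e * 2 ^ N / (\<kappa> * c\<^sup>2) + 32 * L\<^sup>2"
  show ?thesis
  proof (rule that[of K])
    show "0 \<le> K" using e \<kappa> by (simp add: K_def)
    fix z z' :: "(real^'m) \<times> (real^'n)" and h h' :: real
    assume z: "z \<in> sphere 0 1" "z' \<in> sphere 0 1" "\<delta> \<le> norm (fst z)" "\<delta> \<le> norm (snd z)"
      and h: "0 < h" "h \<le> 1" "h / 2 \<le> h'" "h' \<le> h" "dist z z' \<le> h"
    obtain \<Gamma> where \<Gamma>: "finite \<Gamma>" "\<Gamma> \<subseteq> block_orthogonal"
      "\<And>\<gamma> \<gamma>'. \<gamma> \<in> \<Gamma> \<Longrightarrow> \<gamma>' \<in> \<Gamma> \<Longrightarrow> \<gamma> \<noteq> \<gamma>' \<Longrightarrow> 4 * h \<le> dist (block_act \<gamma> z) (block_act \<gamma>' z)"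
      "(norm (fst z) / (4 * h * CARD('m))) ^ (CARD('m) - 1) *
       (norm (snd z) / (4 * h * CARD('n))) ^ (CARD('n) - 1) \<le> card \<Gamma>"
      using orbit_separated_points[of "4 * h" z] h(1) by (metis mult_pos_pos zero_less_numeral)
    define M where "M = real (card \<Gamma>)"
    have "\<kappa> / h ^ (N - 1) = (\<delta> / (4 * h * CARD('m))) ^ (CARD('m) - 1) * (\<delta> / (4 * h * CARD('n))) ^ (CARD('n) - 1)"
      unfolding \<kappa>_def N1(1)[symmetric] power_add by (simp add: power_divide power_mult_distrib)
    also have "\<dots> \<le> (norm (fst z) / (4 * h * CARD('m))) ^ (CARD('m) - 1) *
       (norm (snd z) / (4 * h * CARD('n))) ^ (CARD('n) - 1)"
      using z h(1) \<delta> by (intro mult_mono power_mono divide_right_mono) auto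
    also have "\<dots> \<le> M" using \<Gamma>(4) by (simp add: M_def)
    finally have M: "\<kappa> / h ^ (N - 1) \<le> M" .
    then have M0: "0 < M" using \<kappa> h(1) by (smt (verit) divide_pos_pos zero_less_power)
    define m m' where "m = measure ?S (cap z h)" and "m' = measure ?S (cap z' h')"
    have h': "0 < h'" "h' \<le> 1" using h by auto
    have m: "c * h ^ N \<le> m"
      using cap_volume_lower_bound[OF z(1) h(1,2)] dim by (simp add: m_def c_def cap_def)
    have "c * (h / 2) ^ N \<le> c * h' ^ N" using c h by (intro mult_left_mono power_mono) auto
    also have "\<dots> \<le> m'"
      using cap_volume_lower_bound[OF z(2) h'] dim by (simp add: m'_def c_def cap_def)
    finally have m': "c * (h / 2) ^ N \<le> m'" .
    have m0: "0 < m" "0 < m'" using m m' c h(1) by (smt (verit) mult_pos_pos zero_less_power half_gt_zero)+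
    define X where "X = (cap_mean u h z - cap_mean u h' z')\<^sup>2"
    have "ennreal (M * (X * (m * m'))) = of_nat (card \<Gamma>) * ennreal (X * (m * m'))"
      using m0 by (simp add: M_def X_def ennreal_mult ennreal_of_nat_eq_real_of_nat)
    also have "\<dots> \<le> of_nat (card \<Gamma>) * cap_osc u z h z' h'"
      unfolding X_def m_def m'_def cap_mean_def cap_osc_def
      using m0 int by (intro mult_left_mono set_mean_difference) (auto simp: m_def m'_def)
    also have "\<dots> \<le> ennreal (2 * (4 * h) powr q * e + card \<Gamma> * (32 * L\<^sup>2 * h\<^sup>2 * (m * m')))"
      unfolding m_def m'_def
    proof (rule card_times_cap_osc_le[where T=block_act and z=z, OF u L e _ \<Gamma>(1) _ _ \<Gamma>(3)])
      show "0 \<le> q" using s by (simp add: q_def)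
      show "orthogonal_transformation (block_act \<gamma>)" if "\<gamma> \<in> \<Gamma>" for \<gamma>
        using that \<Gamma>(2) by (blast intro: block_act_orthogonal_transformation)
      show "AE a in ?S. u (block_act \<gamma> a) = u a" if "\<gamma> \<in> \<Gamma>" for \<gamma>
        using that \<Gamma>(2) inv by blast
    qed (use h in auto)
    finally have "M * (X * (m * m')) \<le> 2 * (4 * h) powr q * e + M * (32 * L\<^sup>2 * h\<^sup>2 * (m * m'))"
      using e m0 M0 by (subst (asm) ennreal_le_iff) (auto simp: M_def)
    then have "X \<le> 2 * (4 * h) powr q * e / (M * (m * m')) + 32 * L\<^sup>2 * h\<^sup>2"
      using m0 M0 by (simp add: field_simps)
    also have "2 * (4 * h) powr q * e / (M * (m * m'))
        \<le> 2 * (4 * h) powr q * e / ((\<kappa> / h ^ (N - 1)) * ((c * h ^ N) * (c * (h / 2) ^ N)))"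
      using M m m' m0 M0 c \<kappa> h(1) e by (intro divide_left_mono mult_mono) auto
    also have "\<dots> = 2 * 4 powr q * e * 2 ^ N / (\<kappa> * c\<^sup>2) * (h powr q * h ^ (N - 1) / (h ^ N * h ^ N))"
      using h(1) by (simp add: powr_mult power_divide power2_eq_square mult_ac)
    also have "h powr q * h ^ (N - 1) / (h ^ N * h ^ N) = h powr (q + real (N - 1) - (real N + real N))"
      by (simp only: powr_diff powr_add powr_realpow[OF h(1)])
    also have "q + real (N - 1) - (real N + real N) = 2 * s - 1"
      using N1(2) by (simp add: q_def of_nat_diff)
    \<comment> \<open>As \<open>h \<le> 1\<close> and \<open>2 s - 1 \<le> 2\<close>, the Lipschitz term is of lower order.\<close>
    also have "32 * L\<^sup>2 * h\<^sup>2 \<le> 32 * L\<^sup>2 * h powr (2 * s - 1)"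
    proof (rule mult_left_mono)
      have "h powr 2 \<le> h powr (2 * s - 1)" using h s by (intro powr_mono') auto
      then show "h\<^sup>2 \<le> h powr (2 * s - 1)" using h(1) by simp
    qed simp
    finally show "(cap_mean u h z - cap_mean u h' z')\<^sup>2 \<le> K * h powr (2 * s - 1)"
      by (simp add: X_def K_def algebra_simps)
  qed
qed

section \<open>Limits of sequences with geometrically decreasing increments\<close>

lemma geometric_increments_limit:
  fixes g :: "nat \<Rightarrow> real"
  assumes r: "0 < r" "r < 1" and g: "\<And>k. \<bar>g k - g (Suc k)\<bar> \<le> A * r ^ k"
  shows "convergent g" and "\<bar>g k - lim g\<bar> \<le> A * r ^ k / (1 - r)"
proof -
  have A: "0 \<le> A" using g[of 0] by simp
  have bound: "\<bar>g k - g (k + j)\<bar> \<le> A * r ^ k / (1 - r)" for k j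
  proof -
    have "\<bar>g k - g (k + j)\<bar> \<le> A * r ^ k * (1 - r ^ j) / (1 - r)"
    proof (induction j)
      case (Suc j)
      have "\<bar>g k - g (k + Suc j)\<bar> \<le> \<bar>g k - g (k + j)\<bar> + \<bar>g (k + j) - g (Suc (k + j))\<bar>" by simp
      also have "\<dots> \<le> A * r ^ k * (1 - r ^ j) / (1 - r) + A * r ^ (k + j)"
        by (intro add_mono Suc g)
      also have "\<dots> = A * r ^ k * (1 - r ^ Suc j) / (1 - r)"
        using r by (simp add: field_simps power_add)
      finally show ?case .
    qed simp
    also have "\<dots> \<le> A * r ^ k * 1 / (1 - r)"
      using r A by (intro divide_right_mono mult_left_mono) auto
    finally show ?thesis by simp
  qed
  have "(\<lambda>k. A * r ^ k / (1 - r)) \<longlonglongrightarrow> A * 0 / (1 - r)"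
    using r by (intro tendsto_intros LIMSEQ_realpow_zero) auto
  then have null: "(\<lambda>k. A * r ^ k / (1 - r)) \<longlonglongrightarrow> 0" by simp
  have "Cauchy g"
    unfolding Cauchy_altdef
  proof (intro allI impI)
    fix e :: real assume "0 < e"
    then obtain M where M: "\<And>m. m \<ge> M \<Longrightarrow> A * r ^ m / (1 - r) < e"
      using order_tendstoD(2)[OF null] by (auto simp: eventually_sequentially)
    have "dist (g m) (g n) < e" if "m \<ge> M" "m < n" for m n
      using bound[of m "n - m"] M[OF that(1)] that(2) by (simp add: dist_real_def)
    then show "\<exists>M. \<forall>m\<ge>M. \<forall>n>m. dist (g m) (g n) < e" by blast
  qed
  then show conv: "convergent g" by (simp add: Cauchy_convergent_iff)
  then have "g \<longlonglongrightarrow> lim g" by (simp add: convergent_LIMSEQ_iff)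
  then have "(\<lambda>j. \<bar>g k - g (j + k)\<bar>) \<longlonglongrightarrow> \<bar>g k - lim g\<bar>"
    by (intro tendsto_intros LIMSEQ_ignore_initial_segment)
  then show "\<bar>g k - lim g\<bar> \<le> A * r ^ k / (1 - r)"
    by (rule LIMSEQ_le_const2) (use bound[of k] in \<open>auto simp: add.commute\<close>)
qed

text \<open>
  The functions \<open>f k\<close> need not be continuous: it suffices that \<open>f k\<close> has oscillation of order \<open>r ^ k\<close>
  at distances at most \<open>2^(-k)\<close>.
\<close>
lemma continuous_on_lim_geometric:
  fixes f :: "nat \<Rightarrow> 'a::metric_space \<Rightarrow> real"
  assumes r: "0 < r" "r < 1"
    and f: "\<And>x. x \<in> X \<Longrightarrow> \<exists>A \<epsilon>. 0 < \<epsilon> \<and>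
      (\<forall>y\<in>X. dist x y < \<epsilon> \<longrightarrow> (\<forall>k. \<bar>f k y - f (Suc k) y\<bar> \<le> A * r ^ k)) \<and>
      (\<forall>k. \<forall>y\<in>X. dist x y \<le> (1/2) ^ k \<longrightarrow> \<bar>f k x - f k y\<bar> \<le> A * r ^ k)"
  shows "continuous_on X (\<lambda>x. lim (\<lambda>k. f k x))"
  unfolding continuous_on_iff
proof (intro ballI allI impI)
  fix x and e :: real assume x: "x \<in> X" and e: "0 < e"
  let ?l = "\<lambda>x. lim (\<lambda>k. f k x)"
  obtain A \<epsilon> where \<epsilon>: "0 < \<epsilon>"
    and inc: "\<And>y k. y \<in> X \<Longrightarrow> dist x y < \<epsilon> \<Longrightarrow> \<bar>f k y - f (Suc k) y\<bar> \<le> A * r ^ k"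
    and equi: "\<And>y k. y \<in> X \<Longrightarrow> dist x y \<le> (1/2) ^ k \<Longrightarrow> \<bar>f k x - f k y\<bar> \<le> A * r ^ k"
    using f[OF x] by blast
  have lim: "\<bar>f k y - ?l y\<bar> \<le> A * r ^ k / (1 - r)" if "y \<in> X" "dist x y < \<epsilon>" for y k
    using geometric_increments_limit(2)[OF r inc[OF that]] .
  have "(\<lambda>k. 2 * (A * r ^ k / (1 - r)) + A * r ^ k) \<longlonglongrightarrow> 2 * (A * 0 / (1 - r)) + A * 0"
    using r by (intro tendsto_intros LIMSEQ_realpow_zero) auto
  then have "\<forall>\<^sub>F k in sequentially. 2 * (A * r ^ k / (1 - r)) + A * r ^ k < e"
    using e by (intro order_tendstoD(2)) auto
  then obtain k where k: "2 * (A * r ^ k / (1 - r)) + A * r ^ k < e"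
    by (auto simp: eventually_sequentially)
  show "\<exists>d>0. \<forall>y\<in>X. dist y x < d \<longrightarrow> dist (?l y) (?l x) < e"
  proof (intro exI[of _ "min \<epsilon> ((1/2) ^ k)"] conjI ballI impI)
    fix y assume y: "y \<in> X" "dist y x < min \<epsilon> ((1/2) ^ k)"
    then have d: "dist x y < \<epsilon>" "dist x y \<le> (1/2) ^ k" by (auto simp: dist_commute)
    show "dist (?l y) (?l x) < e"
      using lim[OF y(1) d(1), of k] lim[OF x, of k] equi[OF y(1) d(2)] k \<epsilon>
      by (simp add: dist_real_def)
  qed (use \<epsilon> in simp)
qed

section \<open>Representatives and conclusion\<close>

lemma sigma_finite_sphere_volume:
  "sigma_finite_measure (sphere_volume :: 'a::euclidean_space measure)"
proof -
  interpret S: finite_measure "borel_sphere_volume :: 'a measure" by (rule finite_borel_sphere_volume)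
  have "finite_measure (sphere_volume :: 'a measure)"
    using S.emeasure_finite[of "sphere 0 1"]
    by (intro finite_measureI) (simp add: sphere_volume_def sets_borel_sphere_volume_iff)
  then show ?thesis by (simp add: finite_measure_def)
qed

lemma Hs_sqnorm_finite_imp_gagliardo_finite:
  fixes w :: "'a::euclidean_space \<Rightarrow> real"
  assumes s: "0 < s" "s < 1" and w: "w \<in> borel_measurable sphere_volume"
    and fin: "Hs_sqnorm N s w < \<infinity>"
  shows "(\<integral>\<^sup>+a. (\<integral>\<^sup>+b. gagliardo (real N + 2 * s) w a b \<partial>borel_sphere_volume) \<partial>borel_sphere_volume) < \<infinity>"
proof -
  interpret sigma_finite_measure "sphere_volume :: 'a measure" by (rule sigma_finite_sphere_volume)
  let ?q = "real N + 2 * s"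
  have id: "(\<lambda>x. x) \<in> borel_measurable (sphere_volume :: 'a measure)"
    unfolding sphere_volume_def by (intro measurable_completion id_measurable_borel_sphere_volume)
  \<comment> \<open>If the constant vanished, the energy could be infinite, because \<open>0 * \<infinity> = 0\<close>.\<close>
  have "0 < c_const N s"
    using s unfolding c_const_def by (intro mult_pos_pos divide_pos_pos Gamma_real_pos) auto
  moreover have "ennreal (c_const N s / 2) *
      (\<integral>\<^sup>+p. case_prod (gagliardo ?q w) p \<partial>(sphere_volume \<Otimes>\<^sub>M sphere_volume)) < \<infinity>"
    using fin unfolding Hs_sqnorm_def gagliardo_def[abs_def] by (simp add: ennreal_add_less_top)
  ultimately have "(\<integral>\<^sup>+p. case_prod (gagliardo ?q w) p \<partial>(sphere_volume \<Otimes>\<^sub>M sphere_volume)) < \<infinity>"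
    by (auto simp: ennreal_mult_less_top)
  then have "(\<integral>\<^sup>+a. (\<integral>\<^sup>+b. gagliardo ?q w a b \<partial>sphere_volume) \<partial>sphere_volume) < \<infinity>"
    using nn_integral_fst[OF gagliardo_measurable[OF w id], of ?q] by simp
  then show ?thesis by (simp add: sphere_volume_def nn_integral_completion)
qed

text \<open>
  Passing to a Borel representative removes the completion of the volume from the rest of the
  argument. The function \<open>\<phi>\<close> is a smooth approximation of \<open>u\<close> at distance less than \<open>1\<close>.
\<close>
lemma Hs_sphere_inv_borel_representative:
  fixes u :: "(real^'m) \<times> (real^'n) \<Rightarrow> real"
  assumes s: "0 < s" "s < 1" and u: "u \<in> Hs_sphere_inv N s"
  obtains v \<phi> L where "v \<in> borel_measurable borel_sphere_volume" "integrable borel_sphere_volume v"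
    "AE z in borel_sphere_volume. u z = v z"
    "\<forall>\<gamma>\<in>block_orthogonal. AE z in borel_sphere_volume. v (block_act \<gamma> z) = v z"
    "L-lipschitz_on (sphere 0 1) \<phi>"
    "(\<integral>\<^sup>+a. (\<integral>\<^sup>+b. gagliardo (real N + 2 * s) (\<lambda>x. v x - \<phi> x) a b \<partial>borel_sphere_volume) \<partial>borel_sphere_volume) < \<infinity>"
proof -
  let ?S = "borel_sphere_volume :: ((real^'m) \<times> (real^'n)) measure"
  interpret finite_measure ?S by (rule finite_borel_sphere_volume)
  have um: "u \<in> borel_measurable (completion ?S)"
    and u2: "(\<integral>\<^sup>+z. ennreal ((u z)\<^sup>2) \<partial>?S) < \<infinity>"
    using u by (auto simp: Hs_sphere_inv_def Hs_sphere_def L2_sphere_def sphere_volume_def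
        nn_integral_completion)
  have uinv: "AE z in ?S. u (block_act \<gamma> z) = u z" if "\<gamma> \<in> block_orthogonal" for \<gamma>
    using u that unfolding Hs_sphere_inv_def sphere_volume_def AE_completion_iff by blast
  obtain \<phi> where \<phi>: "smooth_on_sphere \<phi>" "Hs_norm N s (\<lambda>z. u z - \<phi> z) < ennreal 1"
    using u unfolding Hs_sphere_inv_def Hs_sphere_def by (auto dest: spec[of _ 1])
  obtain L where L: "L-lipschitz_on (sphere 0 1) \<phi>" by (rule smooth_on_sphere_lipschitz[OF \<phi>(1)])
  obtain v where v [measurable]: "v \<in> borel_measurable ?S" and uv: "AE z in ?S. u z = v z"
    using completion_ex_borel_measurable_real[OF um] by blast
  have "(\<integral>\<^sup>+z. ennreal ((v z)\<^sup>2) \<partial>?S) = (\<integral>\<^sup>+z. ennreal ((u z)\<^sup>2) \<partial>?S)"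
    using uv by (intro nn_integral_cong_AE) auto
  then have "integrable ?S (\<lambda>z. (v z)\<^sup>2)" using u2 by (intro integrableI_bounded) auto
  then have int: "integrable ?S v" by (rule square_integrable_imp_integrable[OF v])
  have vinv: "AE z in ?S. v (block_act \<gamma> z) = v z" if \<gamma>: "\<gamma> \<in> block_orthogonal" for \<gamma>
  proof -
    note T = distr_borel_sphere_volume_orthogonal[OF block_act_orthogonal_transformation[OF \<gamma>]]
    have "AE z in ?S. u (block_act \<gamma> z) = v (block_act \<gamma> z)"
      by (rule AE_distrD[OF T(1)]) (subst T(2), rule uv)
    with uv uinv[OF \<gamma>] show ?thesis by eventually_elim simp
  qed
  have "Hs_sqnorm N s (\<lambda>z. u z - \<phi> z) < \<infinity>"
    using \<phi>(2) unfolding Hs_norm_def by (auto simp: less_top split: if_splits)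
  moreover have "(\<lambda>z. u z - \<phi> z) \<in> borel_measurable (sphere_volume :: ((real^'m) \<times> (real^'n)) measure)"
    using um measurable_completion[OF lipschitz_measurable_sphere[OF L]]
    unfolding sphere_volume_def by (rule borel_measurable_diff)
  ultimately have "(\<integral>\<^sup>+a. (\<integral>\<^sup>+b. gagliardo (real N + 2 * s) (\<lambda>x. u x - \<phi> x) a b \<partial>?S) \<partial>?S) < \<infinity>"
    using s by (intro Hs_sqnorm_finite_imp_gagliardo_finite)
  moreover have "(\<integral>\<^sup>+a. (\<integral>\<^sup>+b. gagliardo (real N + 2 * s) (\<lambda>x. u x - \<phi> x) a b \<partial>?S) \<partial>?S)
      = (\<integral>\<^sup>+a. (\<integral>\<^sup>+b. gagliardo (real N + 2 * s) (\<lambda>x. v x - \<phi> x) a b \<partial>?S) \<partial>?S)"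
  proof (rule nn_integral_cong_AE, use uv in eventually_elim)
    case (elim a)
    show ?case
      by (rule nn_integral_cong_AE, use uv in eventually_elim) (simp add: gagliardo_def elim)
  qed
  ultimately show ?thesis using that[OF v int uv _ L] vinv by simp
qed

theorem proposition1p5:
  fixes N :: nat and s :: real and u :: "(real^'m) \<times> (real^'n) \<Rightarrow> real"
  assumes "N \<ge> 3"
    and "CARD('m) \<ge> 2" and "CARD('n) \<ge> 2"
    and "CARD('m) + CARD('n) = N + 1"
    and "1/2 < s" and "s < 1"
    and "u \<in> Hs_sphere_inv N s"
  shows "\<exists>u'. continuous_on (sphere 0 1 - singular_set) u' \<and>
           (AE z in sphere_volume. u z = u' z)"
proof -
  let ?S = "borel_sphere_volume :: ((real^'m) \<times> (real^'n)) measure"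
  note N = assms(4) and s = assms(5,6)
  have s0: "0 < s" using s(1) by simp
  obtain v \<phi> L where v: "v \<in> borel_measurable ?S" "integrable ?S v" "AE z in ?S. u z = v z"
    "\<forall>\<gamma>\<in>block_orthogonal. AE z in ?S. v (block_act \<gamma> z) = v z"
    and L: "L-lipschitz_on (sphere 0 1) \<phi>"
    and E: "(\<integral>\<^sup>+a. (\<integral>\<^sup>+b. gagliardo (real N + 2 * s) (\<lambda>x. v x - \<phi> x) a b \<partial>?S) \<partial>?S) < \<infinity>"
    by (rule Hs_sphere_inv_borel_representative[OF s0 s(2) assms(7)])
  define f where "f k = cap_mean v ((1/2) ^ k)" for k
  define r where "r = (1/2) powr (s - 1/2)"
  have r: "0 < r" "r < 1" using s by (auto simp: r_def powr01_less_one)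
  have root: "\<bar>x\<bar> \<le> sqrt K * r ^ k" if "x\<^sup>2 \<le> K * ((1/2) ^ k) powr (2 * s - 1)" for x K k
  proof -
    have "((1/2::real) ^ k) powr (2 * s - 1) = (r ^ k)\<^sup>2"
      by (simp add: r_def powr_powr power_mult algebra_simps flip: powr_realpow)
    then have "sqrt (x\<^sup>2) \<le> sqrt (K * (r ^ k)\<^sup>2)" using that by (intro real_sqrt_le_mono) simp
    then show ?thesis using r by (simp add: real_sqrt_mult)
  qed
  have "continuous_on (sphere 0 1 - singular_set) (\<lambda>z. lim (\<lambda>k. f k z))"
  proof (rule continuous_on_lim_geometric[OF r])
    fix x :: "(real^'m) \<times> (real^'n)" assume x: "x \<in> sphere 0 1 - singular_set"
    obtain x1 x2 where x12: "x = (x1, x2)" by (cases x)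
    have x0: "x1 \<noteq> 0" "x2 \<noteq> 0"
      using x unfolding x12 by (auto simp: singular_set_def)
    \<comment> \<open>Half the smaller block norm of \<open>x\<close>, so that the estimate holds at all points near \<open>x\<close>.\<close>
    define \<delta> where "\<delta> = min (norm (fst x)) (norm (snd x)) / 2"
    have \<delta>: "0 < \<delta>" using x0 by (simp add: \<delta>_def x12)
    obtain K where K: "0 \<le> K"
      "\<And>z z' h h'. \<lbrakk>z \<in> sphere 0 1; z' \<in> sphere 0 1; \<delta> \<le> norm (fst z); \<delta> \<le> norm (snd z);
        0 < h; h \<le> 1; h / 2 \<le> h'; h' \<le> h; dist z z' \<le> h\<rbrakk>
       \<Longrightarrow> (cap_mean v h z - cap_mean v h' z')\<^sup>2 \<le> K * h powr (2 * s - 1)"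
      using cap_mean_holder_estimate[OF N s v(1,2,4) L E \<delta>] by blast
    have near: "\<delta> \<le> norm (fst y)" "\<delta> \<le> norm (snd y)" if "dist x y < \<delta>" for y
      using dist_fst_le[of x y] dist_snd_le[of x y] that norm_triangle_ineq2[of "fst x" "fst y"]
        norm_triangle_ineq2[of "snd x" "snd y"]
      by (auto simp: \<delta>_def dist_norm min_def split: if_splits)
    show "\<exists>A \<epsilon>. 0 < \<epsilon> \<and>
      (\<forall>y\<in>sphere 0 1 - singular_set. dist x y < \<epsilon> \<longrightarrow> (\<forall>k. \<bar>f k y - f (Suc k) y\<bar> \<le> A * r ^ k)) \<and>
      (\<forall>k. \<forall>y\<in>sphere 0 1 - singular_set. dist x y \<le> (1/2) ^ k \<longrightarrow> \<bar>f k x - f k y\<bar> \<le> A * r ^ k)"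
    proof (rule exI[of _ "sqrt K"], rule exI[of _ \<delta>], intro conjI ballI impI allI)
      fix y k assume "y \<in> sphere 0 1 - singular_set" "dist x y < \<delta>"
      then show "\<bar>f k y - f (Suc k) y\<bar> \<le> sqrt K * r ^ k"
        unfolding f_def using near by (intro root K(2)) (auto simp: power_le_one)
    next
      fix y k assume "y \<in> sphere 0 1 - singular_set" "dist x y \<le> (1/2) ^ k"
      then show "\<bar>f k x - f k y\<bar> \<le> sqrt K * r ^ k"
        unfolding f_def using near[of x] x \<delta> by (intro root K(2)) (auto simp: power_le_one)
    qed (rule \<delta>)
  qed
  moreover have "AE z in ?S. u z = lim (\<lambda>k. f k z)"
  proof -
    have "real (DIM((real^'m) \<times> (real^'n)) - 1) < real N + 2 * s" using N s by simp
    from cap_mean_converges_AE[OF v(1,2) L E this] v(3)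
    show ?thesis by eventually_elim (simp add: f_def limI)
  qed
  then have "AE z in sphere_volume. u z = lim (\<lambda>k. f k z)"
    unfolding sphere_volume_def AE_completion_iff .
  ultimately show ?thesis by blast
qed

end
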